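(* Suppose $M_\Theta:\Gamma\otimes\mathcal D\to\Gamma\otimes\mathcal L$ is a contractive multi-analytic operator with symbol $\Theta$, where $\mathcal D$ and $\mathcal L$ are Hilbert spaces. Then, with the subspaces $\mathcal L_A$, $\mathcal L_E$ and the row isometry $\underline V^{\mathcal D}$ of the associated functional model, the following hold: (a) $\mathcal L_A=\mathcal L_E$ if and only if for all $\delta\in\mathcal D$: $\Theta(\delta)\in e_\emptyset\otimes\mathcal L$ implies $\Theta(\delta)=0$. (b) $\mathcal L_E=\ker(\underline V^{\mathcal D})^*$ if and only if $\Theta$ is injective. (c) $\mathcal L_A=\ker(\underline V^{\mathcal D})^*$ if and only if $\Theta$ has no constant directions.
   Context: Hilbert spaces are complex; $d\ge1$ is a fixed integer. $\Gamma=\bigoplus_{n\ge0}(\mathbb C^d)^{\otimes n}$ is the full Fock space, $e_\emptyset$ its vacuum vector, $L_j$ the left creation operator $L_jx=e_j\otimes x$ ($j=1,\dots,d$). A bounded operator $M_\Theta:\Gamma\otimes\mathcal D\to\Gamma\otimes\mathcal L$ is multi-analytic if $M_\Theta(L_j\otimes I)=(L_j\otimes I)M_\Theta$ for all $j$; its symbol is $\Theta:\mathcal D\to\Gamma\otimes\mathcal L$, $\Theta(\delta)=M_\Theta(e_\emptyset\otimes\delta)$. It is contractive if $\|M_\Theta\|\le1$. The symbol $\Theta$ has no constant directions if $\Theta(\delta)\in e_\emptyset\otimes\mathcal L$ only for $\delta=0$. **Functional model.** Let $\Delta_\Theta=(I-M_\Theta^*M_\Theta)^{1/2}$, $\mathcal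 H_\Theta=(\Gamma\otimes\mathcal L)\oplus\overline{\Delta_\Theta(\Gamma\otimes\mathcal D)}$, and let $\underline V=(V_1,\dots,V_d)$ be the row isometry (isometries with orthogonal ranges) on $\mathcal H_\Theta$ with $V_j(\eta\oplus\Delta_\Theta\xi)=(L_j\otimes I)\eta\oplus\Delta_\Theta(L_j\otimes I)\xi$ for $\xi\in\Gamma\otimes\mathcal D$, $\eta\in\Gamma\otimes\mathcal L$. Let $\mathcal H_{\mathcal D}=\{M_\Theta\xi\oplus\Delta_\Theta\xi:\xi\in\Gamma\otimes\mathcal D\}$, a closed $\underline V$-invariant subspace, and $\underline V^{\mathcal D}=(V_1|_{\mathcal H_{\mathcal D}},\dots,V_d|_{\mathcal H_{\mathcal D}})$ on $\mathcal H_{\mathcal D}$. Here a $d$-tuple is regarded as an operator $\bigoplus_1^d\mathcal H_{\mathcal D}\to\mathcal H_{\mathcal D}$, so $\ker(\underline V^{\mathcal D})^*=\bigcap_j\ker(V_j|_{\mathcal H_{\mathcal D}})^*\subset\mathcal H_{\mathcal D}$. Put $$\mathcal H_A=\mathcal H_\Theta\ominus\mathcal H_{\mathcal D},\quad \mathcal L_A=\overline{\mathrm{span}}\{\mathcal H_A,V_1\mathcal H_A,\dots,V_d\mathcal H_A\}\ominus\mathcal H_A,\quad \mathcal L_E=\overline{\mathrm{span}}\{\mathcal L_A,P_{\mathcal H_{\mathcal D}}(e_\emptyset\otimes\mathcal L)\},$$ where $P_{\mathcal H_{\mathcal D}}$ is the orthogonal projection of $\mathcal H_\Theta$ onto $\mathcal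 H_{\mathcal D}$ and $e_\emptyset\otimes\mathcal L$ is regarded as the subspace $(e_\emptyset\otimes\mathcal L)\oplus0$ of $\mathcal H_\Theta$. *)

theory Defs
  imports "HOL-Analysis.Analysis"
begin

section \<open>Complex Hilbert spaces\<close>

text \<open>The complex inner product is linear in its first argument. Its real part is the library's
  real inner product, so that norm, topology and completeness are those of \<^class>\<open>real_inner\<close>;
  positive definiteness is inherited from there.\<close>

class complex_inner = real_inner +
  fixes scaleC :: "complex \<Rightarrow> 'a \<Rightarrow> 'a"  (infixr "*\<^sub>C" 75)
    and cinner :: "'a \<Rightarrow> 'a \<Rightarrow> complex"
  assumes scaleC_add_right: "c *\<^sub>C (x + y) = c *\<^sub>C x + c *\<^sub>C y"
    and scaleC_add_left: "(b + c) *\<^sub>C x = b *\<^sub>C x + c *\<^sub>C x"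
    and scaleC_scaleC: "b *\<^sub>C (c *\<^sub>C x) = (b * c) *\<^sub>C x"
    and scaleR_eq_scaleC: "scaleR r x = complex_of_real r *\<^sub>C x"
    and cinner_commute: "cinner x y = cnj (cinner y x)"
    and cinner_add_left: "cinner (x + y) z = cinner x z + cinner y z"
    and cinner_scaleC_left: "cinner (c *\<^sub>C x) y = c * cinner x y"
    and inner_eq_Re_cinner: "inner x y = Re (cinner x y)"

class chilbert_space = complex_inner + complete_space

lemma scaleC_one: "1 *\<^sub>C x = (x::'a::complex_inner)"
  using scaleR_eq_scaleC[of 1 x] by simp

global_interpretation complex_vector:
  vector_space "scaleC :: complex \<Rightarrow> 'a \<Rightarrow> 'a::complex_inner"
  by unfold_locales (auto simp: scaleC_add_right scaleC_add_left scaleC_scaleC scaleC_one)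

lemma cinner_add_right: "cinner x (y + z) = cinner x y + cinner x (z::'a::complex_inner)"
  by (simp add: cinner_commute[of x "y + z"] cinner_commute[of x y] cinner_commute[of x z]
      cinner_add_left)

lemma cinner_scaleC_right: "cinner x (c *\<^sub>C y) = cnj c * cinner x (y::'a::complex_inner)"
  by (simp add: cinner_commute[of x "c *\<^sub>C y"] cinner_commute[of x y] cinner_scaleC_left)

lemma cinner_zero_left: "cinner 0 x = 0" and cinner_zero_right: "cinner x 0 = 0"
  for x :: "'a::complex_inner"
  using cinner_add_left[of 0 0 x] cinner_add_right[of x 0 0] by simp_all

lemma cinner_self: "cinner x x = complex_of_real ((norm x)\<^sup>2)"
  for x :: "'a::complex_inner"
proof -
  have "Im (cinner x x) = 0"
    using arg_cong[OF cinner_commute[of x x], of Im] by simp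
  moreover have "Re (cinner x x) = (norm x)\<^sup>2"
    by (simp add: power2_norm_eq_inner inner_eq_Re_cinner)
  ultimately show ?thesis
    by (simp add: complex_eq_iff)
qed

lemma norm_scaleC: "norm (c *\<^sub>C x) = norm c * norm (x::'a::complex_inner)"
proof -
  have "complex_of_real ((norm (c *\<^sub>C x))\<^sup>2) = (c * cnj c) * complex_of_real ((norm x)\<^sup>2)"
    unfolding cinner_self[symmetric] cinner_scaleC_left cinner_scaleC_right by (simp only: ac_simps)
  also have "\<dots> = complex_of_real ((norm c * norm x)\<^sup>2)"
    by (simp add: complex_norm_square[symmetric] power_mult_distrib)
  finally have "(norm (c *\<^sub>C x))\<^sup>2 = (norm c * norm x)\<^sup>2"
    by (simp only: of_real_eq_iff)
  then show ?thesis
    by (simp add: power2_eq_iff_nonneg)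
qed

lemma norm_cinner_le: "norm (cinner x y) \<le> norm x * norm (y::'a::complex_inner)"
proof (cases "cinner x y = 0")
  case False
  define c where "c = cnj (cinner x y) / norm (cinner x y)"
  have nc: "norm c = 1"
    using False by (simp add: c_def norm_divide)
  have "c * cinner x y = norm (cinner x y)"
    using False complex_norm_square[of "cinner x y"]
    by (simp add: c_def field_simps power2_eq_square)
  then have "norm (cinner x y) = Re (cinner (c *\<^sub>C x) y)"
    by (simp add: cinner_scaleC_left)
  also have "\<dots> = inner (c *\<^sub>C x) y"
    by (simp add: inner_eq_Re_cinner)
  also have "\<dots> \<le> norm (c *\<^sub>C x) * norm y"
    by (rule norm_cauchy_schwarz)
  finally show ?thesis
    by (simp add: norm_scaleC nc)
qed simp

instantiation complex :: complex_inner
begin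
definition scaleC_complex :: "complex \<Rightarrow> complex \<Rightarrow> complex" where "scaleC_complex c x = c * x"
definition cinner_complex :: "complex \<Rightarrow> complex \<Rightarrow> complex" where "cinner_complex x y = x * cnj y"
instance
  by standard (auto simp: scaleC_complex_def cinner_complex_def algebra_simps scaleR_conv_of_real
      inner_complex_def)
end

instance complex :: chilbert_space ..

instantiation prod :: (complex_inner, complex_inner) complex_inner
begin
definition scaleC_prod :: "complex \<Rightarrow> 'a \<times> 'b \<Rightarrow> 'a \<times> 'b"
  where "scaleC_prod c x = (c *\<^sub>C fst x, c *\<^sub>C snd x)"
definition cinner_prod :: "'a \<times> 'b \<Rightarrow> 'a \<times> 'b \<Rightarrow> complex"
  where "cinner_prod x y = cinner (fst x) (fst y) + cinner (snd x) (snd y)"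
instance
proof
  fix x y :: "'a \<times> 'b"
  show "cinner x y = cnj (cinner y x)"
    by (simp add: cinner_prod_def cinner_commute[of "fst y" "fst x"]
        cinner_commute[of "snd y" "snd x"])
qed (auto simp: scaleC_prod_def cinner_prod_def scaleC_add_right scaleC_add_left scaleC_scaleC
      scaleR_eq_scaleC cinner_add_left cinner_scaleC_left inner_prod_def inner_eq_Re_cinner
      algebra_simps prod_eq_iff)
end

instance prod :: (chilbert_space, chilbert_space) chilbert_space ..

section \<open>Bounded operators and subspaces\<close>

definition bounded_clinear :: "('a::complex_inner \<Rightarrow> 'b::complex_inner) \<Rightarrow> bool" where
  "bounded_clinear T \<longleftrightarrow> bounded_linear T \<and> (\<forall>c x. T (c *\<^sub>C x) = c *\<^sub>C T x)"

text \<open>For a closed subspace \<open>S\<close>, this is the adjoint of the restriction of \<open>T\<close> to \<open>S\<close>, mapping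
  into \<open>S\<close>. If \<open>T\<close> leaves \<open>S\<close> invariant, its values on \<open>S\<close> are those of the adjoint of
  \<open>T|S : S \<rightarrow> S\<close>. The ordinary adjoint is the case \<open>S = UNIV\<close>.\<close>

definition adjoint_on :: "'a::complex_inner set \<Rightarrow> ('a \<Rightarrow> 'b::complex_inner) \<Rightarrow> 'b \<Rightarrow> 'a" where
  "adjoint_on S T y = (THE z. z \<in> S \<and> (\<forall>x\<in>S. cinner (T x) y = cinner x z))"

definition positive_op :: "('a::complex_inner \<Rightarrow> 'a) \<Rightarrow> bool" where
  "positive_op T \<longleftrightarrow> bounded_clinear T \<and> (\<forall>x. cinner (T x) x \<in> \<real>\<^sub>\<ge>\<^sub>0)"

text \<open>A positive operator on a Hilbert space has exactly one positive square root.\<close>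

definition sqrt_op :: "('a::complex_inner \<Rightarrow> 'a) \<Rightarrow> 'a \<Rightarrow> 'a" where
  "sqrt_op T = (SOME S. positive_op S \<and> S \<circ> S = T)"

definition closed_span :: "'a::complex_inner set \<Rightarrow> 'a set" where
  "closed_span S = closure (complex_vector.span S)"

definition orth_diff :: "'a::complex_inner set \<Rightarrow> 'a set \<Rightarrow> 'a set"  (infixl "\<ominus>" 65) where
  "A \<ominus> B = {x \<in> A. \<forall>y\<in>B. cinner x y = 0}"

definition orth_proj :: "'a::complex_inner set \<Rightarrow> 'a \<Rightarrow> 'a" where
  "orth_proj S x = (THE y. y \<in> S \<and> (\<forall>z\<in>S. cinner (x - y) z = 0))"

section \<open>Hilbert space direct sums of copies of a Hilbert space\<close>

definition square_summable :: "('i \<Rightarrow> 'a::real_inner) \<Rightarrow> bool" where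
  "square_summable f \<longleftrightarrow> (\<lambda>i. (norm (f i))\<^sup>2) summable_on UNIV"

lemma square_summable_comparison:
  assumes "g summable_on UNIV" "\<And>i. (norm (f i))\<^sup>2 \<le> g i"
  shows "square_summable f"
  unfolding square_summable_def
  by (rule summable_on_comparison_test[OF assms(1)]) (use assms(2) in auto)

lemma square_summable_zero: "square_summable (\<lambda>i. 0)"
  by (simp add: square_summable_def)

lemma square_summable_uminus: "square_summable f \<Longrightarrow> square_summable (\<lambda>i. - f i)"
  by (simp add: square_summable_def)

lemma square_summable_scaleR: "square_summable f \<Longrightarrow> square_summable (\<lambda>i. r *\<^sub>R f i)"
  by (simp add: square_summable_def power_mult_distrib summable_on_cmult_right)

lemma square_summable_scaleC: "square_summable f \<Longrightarrow> square_summable (\<lambda>i. c *\<^sub>C f i)"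
  by (simp add: square_summable_def norm_scaleC power_mult_distrib summable_on_cmult_right)

lemma square_summable_add:
  assumes "square_summable f" "square_summable g"
  shows "square_summable (\<lambda>i. f i + g i)"
proof (rule square_summable_comparison)
  show "(\<lambda>i. 2 * (norm (f i))\<^sup>2 + 2 * (norm (g i))\<^sup>2) summable_on UNIV"
    using assms by (intro summable_on_add summable_on_cmult_right) (auto simp: square_summable_def)
  fix i
  have "(norm (f i + g i))\<^sup>2 \<le> (norm (f i) + norm (g i))\<^sup>2"
    by (intro power_mono norm_triangle_ineq) auto
  also have "\<dots> \<le> 2 * (norm (f i))\<^sup>2 + 2 * (norm (g i))\<^sup>2"
    using sum_squares_bound[of "norm (f i)" "norm (g i)"] by (simp add: power2_sum)
  finally show "(norm (f i + g i))\<^sup>2 \<le> 2 * (norm (f i))\<^sup>2 + 2 * (norm (g i))\<^sup>2" .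
qed

lemma square_summable_diff:
  assumes "square_summable f" "square_summable g"
  shows "square_summable (\<lambda>i. f i - g i)"
  using square_summable_add[OF assms(1) square_summable_uminus[OF assms(2)]] by simp

lemma summable_norm_mult_norm:
  assumes "square_summable f" "square_summable g"
  shows "(\<lambda>i. norm (f i) * norm (g i)) summable_on UNIV"
proof (rule summable_on_comparison_test)
  show "(\<lambda>i. (norm (f i))\<^sup>2 + (norm (g i))\<^sup>2) summable_on UNIV"
    using assms by (intro summable_on_add) (auto simp: square_summable_def)
  fix i
  show "norm (f i) * norm (g i) \<le> (norm (f i))\<^sup>2 + (norm (g i))\<^sup>2"
    using sum_squares_bound[of "norm (f i)" "norm (g i)"]
      mult_nonneg_nonneg[OF norm_ge_zero norm_ge_zero, of "f i" "g i"] by linarith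
qed auto

lemma summable_inner:
  assumes "square_summable f" "square_summable g"
  shows "(\<lambda>i. inner (f i) (g i)) summable_on UNIV"
  by (rule abs_summable_summable, rule summable_on_comparison_test[OF summable_norm_mult_norm[OF assms]])
     (simp_all add: Cauchy_Schwarz_ineq2)

lemma summable_cinner:
  assumes "square_summable f" "square_summable g"
  shows "(\<lambda>i. cinner (f i) (g i)) summable_on UNIV"
  by (rule abs_summable_summable, rule summable_on_comparison_test[OF summable_norm_mult_norm[OF assms]])
     (simp_all add: norm_cinner_le)

typedef (overloaded) ('i, 'a) ell2 = "{f :: 'i \<Rightarrow> 'a::real_inner. square_summable f}"
  morphisms coord Abs_ell2
  using square_summable_zero by auto

setup_lifting type_definition_ell2

lemma square_summable_coord: "square_summable (coord x)"
  using coord by auto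

lemma ell2_eqI: "(\<And>i. coord x i = coord y i) \<Longrightarrow> x = y"
  by (subst coord_inject[symmetric], rule ext)

instantiation ell2 :: (type, real_inner) real_vector
begin
lift_definition zero_ell2 :: "('a, 'b) ell2" is "\<lambda>i. 0" by (rule square_summable_zero)
lift_definition plus_ell2 :: "('a, 'b) ell2 \<Rightarrow> ('a, 'b) ell2 \<Rightarrow> ('a, 'b) ell2"
  is "\<lambda>f g i. f i + g i" by (rule square_summable_add)
lift_definition uminus_ell2 :: "('a, 'b) ell2 \<Rightarrow> ('a, 'b) ell2"
  is "\<lambda>f i. - f i" by (rule square_summable_uminus)
lift_definition minus_ell2 :: "('a, 'b) ell2 \<Rightarrow> ('a, 'b) ell2 \<Rightarrow> ('a, 'b) ell2"
  is "\<lambda>f g i. f i - g i" by (rule square_summable_diff)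
lift_definition scaleR_ell2 :: "real \<Rightarrow> ('a, 'b) ell2 \<Rightarrow> ('a, 'b) ell2"
  is "\<lambda>r f i. r *\<^sub>R f i" by (rule square_summable_scaleR)
instance
  by standard (transfer; simp add: algebra_simps; fail)+
end

instantiation ell2 :: (type, real_inner) real_inner
begin
definition inner_ell2 :: "('a, 'b) ell2 \<Rightarrow> ('a, 'b) ell2 \<Rightarrow> real" where
  "inner_ell2 x y = (\<Sum>\<^sub>\<infinity>i. inner (coord x i) (coord y i))"
definition norm_ell2 :: "('a, 'b) ell2 \<Rightarrow> real" where
  "norm_ell2 x = sqrt (inner x x)"
definition sgn_ell2 :: "('a, 'b) ell2 \<Rightarrow> ('a, 'b) ell2" where
  "sgn_ell2 x = x /\<^sub>R norm x"
definition dist_ell2 :: "('a, 'b) ell2 \<Rightarrow> ('a, 'b) ell2 \<Rightarrow> real" where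
  "dist_ell2 x y = norm (x - y)"
definition uniformity_ell2 :: "(('a, 'b) ell2 \<times> ('a, 'b) ell2) filter" where
  "uniformity_ell2 = (INF e\<in>{0 <..}. principal {(x, y). dist x y < e})"
definition open_ell2 :: "('a, 'b) ell2 set \<Rightarrow> bool" where
  "open_ell2 U \<longleftrightarrow> (\<forall>x\<in>U. \<forall>\<^sub>F (x', y) in uniformity. x' = x \<longrightarrow> y \<in> U)"

instance
proof
  fix x y z :: "('a, 'b) ell2" and r :: real and U :: "('a, 'b) ell2 set"
  show "sgn x = x /\<^sub>R norm x" by (rule sgn_ell2_def)
  show "dist x y = norm (x - y)" by (rule dist_ell2_def)
  show "uniformity = (INF e\<in>{0 <..}. principal {(x, y :: ('a, 'b) ell2). dist x y < e})"
    by (rule uniformity_ell2_def)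
  show "open U \<longleftrightarrow> (\<forall>x\<in>U. \<forall>\<^sub>F (x', y) in uniformity. x' = x \<longrightarrow> y \<in> U)"
    by (rule open_ell2_def)
  note sm = summable_inner[OF square_summable_coord square_summable_coord]
  show "inner x y = inner y x"
    unfolding inner_ell2_def by (intro infsum_cong inner_commute)
  show "inner (x + y) z = inner x z + inner y z"
    by (simp add: inner_ell2_def plus_ell2.rep_eq inner_add_left infsum_add[OF sm sm])
  show "inner (r *\<^sub>R x) y = r * inner x y"
    by (simp add: inner_ell2_def scaleR_ell2.rep_eq infsum_cmult_right')
  show "0 \<le> inner x x"
    by (simp add: inner_ell2_def infsum_nonneg)
  show "inner x x = 0 \<longleftrightarrow> x = 0"
  proof
    assume "inner x x = 0"
    then have "inner (coord x i) (coord x i) = 0" for i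
      by (intro nonneg_infsum_le_0D[where f = "\<lambda>i. inner (coord x i) (coord x i)" and A = UNIV] sm)
         (simp_all add: inner_ell2_def)
    then show "x = 0"
      by (intro ell2_eqI) (simp add: zero_ell2.rep_eq)
  qed (simp add: inner_ell2_def zero_ell2.rep_eq)
  show "norm x = sqrt (inner x x)" by (rule norm_ell2_def)
qed
end

lemma norm_ell2_square: "(norm x)\<^sup>2 = (\<Sum>\<^sub>\<infinity>i. (norm (coord x i))\<^sup>2)"
  by (simp add: power2_norm_eq_inner inner_ell2_def)

lemma norm_coord_le: "norm (coord x i) \<le> norm x"
proof -
  have "sum (\<lambda>i. (norm (coord x i))\<^sup>2) {i} \<le> (norm x)\<^sup>2"
    unfolding norm_ell2_square
    by (rule finite_sum_le_infsum)
       (use square_summable_coord[of x] in \<open>auto simp: square_summable_def\<close>)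
  then have "(norm (coord x i))\<^sup>2 \<le> (norm x)\<^sup>2"
    by simp
  then show ?thesis
    by (rule power2_le_imp_le) simp
qed

instance ell2 :: (type, "{real_inner, complete_space}") complete_space
proof
  fix X :: "nat \<Rightarrow> ('a, 'b) ell2"
  assume X: "Cauchy X"
  have "Cauchy (\<lambda>n. coord (X n) i)" for i
    unfolding Cauchy_def
  proof safe
    fix e :: real
    assume "e > 0"
    with X obtain N where N: "\<forall>m\<ge>N. \<forall>n\<ge>N. dist (X m) (X n) < e"
      unfolding Cauchy_def by blast
    show "\<exists>N. \<forall>m\<ge>N. \<forall>n\<ge>N. dist (coord (X m) i) (coord (X n) i) < e"
    proof (intro exI[of _ N] allI impI)
      fix m n assume "m \<ge> N" "n \<ge> N"
      then show "dist (coord (X m) i) (coord (X n) i) < e"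
        using N[rule_format, of m n] norm_coord_le[of "X m - X n" i]
        by (simp add: dist_norm minus_ell2.rep_eq)
    qed
  qed
  then have "\<exists>f. \<forall>i. (\<lambda>n. coord (X n) i) \<longlonglongrightarrow> f i"
    by (meson Cauchy_convergent convergent_def)
  then obtain f where f: "\<And>i. (\<lambda>n. coord (X n) i) \<longlonglongrightarrow> f i"
    by blast
  have partial: "(\<Sum>i\<in>F. (norm (coord (X m) i - f i))\<^sup>2) \<le> e\<^sup>2"
    if "finite F" and N: "\<forall>m\<ge>N. \<forall>n\<ge>N. dist (X m) (X n) < e" and "m \<ge> N"
    for F N m and e :: real
  proof (rule tendsto_upperbound)
    show "(\<lambda>n. \<Sum>i\<in>F. (norm (coord (X m) i - coord (X n) i))\<^sup>2)
        \<longlonglongrightarrow> (\<Sum>i\<in>F. (norm (coord (X m) i - f i))\<^sup>2)"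
      by (intro tendsto_intros f)
    show "\<forall>\<^sub>F n in sequentially. (\<Sum>i\<in>F. (norm (coord (X m) i - coord (X n) i))\<^sup>2) \<le> e\<^sup>2"
      using eventually_ge_at_top[of N]
    proof eventually_elim
      case (elim n)
      have "(\<Sum>i\<in>F. (norm (coord (X m - X n) i))\<^sup>2) \<le> (norm (X m - X n))\<^sup>2"
        unfolding norm_ell2_square
        by (rule finite_sum_le_infsum)
           (use square_summable_coord[of "X m - X n"] \<open>finite F\<close> in \<open>auto simp: square_summable_def\<close>)
      also have "\<dots> \<le> e\<^sup>2"
        using N[rule_format, OF \<open>m \<ge> N\<close> elim] by (intro power_mono) (auto simp: dist_norm)
      finally show ?case
        by (simp add: minus_ell2.rep_eq)
    qed
  qed simp
  have diff: "square_summable (\<lambda>i. coord (X m) i - f i)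
      \<and> (\<Sum>\<^sub>\<infinity>i. (norm (coord (X m) i - f i))\<^sup>2) \<le> e\<^sup>2"
    if N: "\<forall>m\<ge>N. \<forall>n\<ge>N. dist (X m) (X n) < e" and "m \<ge> N"
    for N m and e :: real
  proof
    note bound = partial[OF _ N \<open>m \<ge> N\<close>]
    have "bdd_above (sum (\<lambda>i. (norm (coord (X m) i - f i))\<^sup>2) ` {F. F \<subseteq> UNIV \<and> finite F})"
      by (rule bdd_aboveI2[where M = "e\<^sup>2"]) (simp add: bound)
    then have sm: "(\<lambda>i. (norm (coord (X m) i - f i))\<^sup>2) summable_on UNIV"
      by (intro nonneg_bdd_above_summable_on) simp_all
    then show "square_summable (\<lambda>i. coord (X m) i - f i)"
      by (simp add: square_summable_def)
    show "(\<Sum>\<^sub>\<infinity>i. (norm (coord (X m) i - f i))\<^sup>2) \<le> e\<^sup>2"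
      by (rule infsum_le_finite_sums[OF sm]) (rule bound)
  qed
  obtain N1 where N1: "\<forall>m\<ge>N1. \<forall>n\<ge>N1. dist (X m) (X n) < 1"
    using X[unfolded Cauchy_def, rule_format, OF zero_less_one] by blast
  have "square_summable (\<lambda>i. coord (X N1) i - (coord (X N1) i - f i))"
    by (rule square_summable_diff[OF square_summable_coord diff[OF N1 order_refl, THEN conjunct1]])
  then have f_ss: "square_summable f"
    by simp
  define x where "x = Abs_ell2 f"
  have cx: "coord x = f"
    using f_ss by (simp add: x_def Abs_ell2_inverse)
  have "X \<longlonglongrightarrow> x"
    unfolding LIMSEQ_def
  proof (intro allI impI)
    fix e :: real
    assume "e > 0"
    then have "e / 2 > 0" by simp
    then obtain N where N: "\<forall>m\<ge>N. \<forall>n\<ge>N. dist (X m) (X n) < e / 2"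
      using X unfolding Cauchy_def by blast
    show "\<exists>N. \<forall>n\<ge>N. dist (X n) x < e"
    proof (intro exI[of _ N] allI impI)
      fix n assume "n \<ge> N"
      then have "(norm (X n - x))\<^sup>2 \<le> (e / 2)\<^sup>2"
        using diff[OF N \<open>n \<ge> N\<close>] by (simp add: norm_ell2_square minus_ell2.rep_eq cx)
      then have "norm (X n - x) \<le> e / 2"
        by (rule power2_le_imp_le) (use \<open>e > 0\<close> in simp)
      then show "dist (X n) x < e"
        using \<open>e > 0\<close> by (simp add: dist_norm)
    qed
  qed
  then show "convergent X"
    by (rule convergentI)
qed

instantiation ell2 :: (type, complex_inner) complex_inner
begin
lift_definition scaleC_ell2 :: "complex \<Rightarrow> ('a, 'b) ell2 \<Rightarrow> ('a, 'b) ell2"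
  is "\<lambda>c f i. c *\<^sub>C f i" by (rule square_summable_scaleC)
definition cinner_ell2 :: "('a, 'b) ell2 \<Rightarrow> ('a, 'b) ell2 \<Rightarrow> complex" where
  "cinner_ell2 x y = (\<Sum>\<^sub>\<infinity>i. cinner (coord x i) (coord y i))"
instance
proof
  fix x y z :: "('a, 'b) ell2" and b c :: complex and r :: real
  show "c *\<^sub>C (x + y) = c *\<^sub>C x + c *\<^sub>C y" "(b + c) *\<^sub>C x = b *\<^sub>C x + c *\<^sub>C x"
    "b *\<^sub>C c *\<^sub>C x = (b * c) *\<^sub>C x" "r *\<^sub>R x = complex_of_real r *\<^sub>C x"
    by (transfer; simp add: scaleC_add_right scaleC_add_left scaleC_scaleC scaleR_eq_scaleC; fail)+
  note sm = summable_cinner[OF square_summable_coord square_summable_coord]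
  show "cinner x y = cnj (cinner y x)"
    unfolding cinner_ell2_def infsum_cnj[symmetric]
    by (rule infsum_cong) (rule cinner_commute)
  show "cinner (x + y) z = cinner x z + cinner y z"
    by (simp add: cinner_ell2_def plus_ell2.rep_eq cinner_add_left infsum_add[OF sm sm])
  show "cinner (c *\<^sub>C x) y = c * cinner x y"
    by (simp add: cinner_ell2_def scaleC_ell2.rep_eq cinner_scaleC_left infsum_cmult_right')
  show "inner x y = Re (cinner x y)"
    by (simp add: inner_ell2_def cinner_ell2_def inner_eq_Re_cinner infsum_Re[OF sm])
qed
end

instance ell2 :: (type, chilbert_space) chilbert_space ..

section \<open>The Fock space\<close>

text \<open>The index type \<open>'j\<close> has \<open>d\<close> elements. A word \<open>[j\<^sub>1, \<dots>, j\<^sub>n]\<close> stands for the vector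
  \<open>e\<^sub>j\<^sub>1 \<otimes> \<dots> \<otimes> e\<^sub>j\<^sub>n\<close> of the orthonormal basis of the \<open>n\<close>-th tensor power of \<open>d\<close>-dimensional space.
  So \<open>('j, 'a) fock\<close> is the Hilbert space tensor product of the full Fock space with \<open>'a\<close>, and
  \<open>('j, complex) fock\<close> is the full Fock space itself; see \<open>cinner_tensor\<close> and
  \<open>closed_span_tensor\<close> below.\<close>

type_synonym ('j, 'a) fock = "('j list, 'a) ell2"

lift_definition tensor ::
    "('j, complex) fock \<Rightarrow> 'a::complex_inner \<Rightarrow> ('j, 'a) fock"
  is "\<lambda>x a w. x w *\<^sub>C a"
proof -
  fix x :: "'j list \<Rightarrow> complex" and a :: 'a
  assume "square_summable x"
  then show "square_summable (\<lambda>w. x w *\<^sub>C a)"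
    by (simp add: square_summable_def norm_scaleC power_mult_distrib summable_on_cmult_left)
qed

lemma square_summable_finite_support:
  assumes "finite {i. f i \<noteq> 0}"
  shows "square_summable f"
  unfolding square_summable_def
  by (rule finite_nonzero_values_imp_summable_on) (use assms in simp)

text \<open>The basis vector \<open>e\<^sub>w\<close>; in particular \<open>e_word []\<close> is the vacuum vector.\<close>

lift_definition e_word :: "'j list \<Rightarrow> ('j, complex) fock"
  is "\<lambda>w v. if v = w then 1 else 0"
  by (rule square_summable_finite_support) simp

text \<open>The operator \<open>L\<^sub>j \<otimes> I\<close>, and \<open>L\<^sub>j\<close> itself for \<open>'a = complex\<close>; see \<open>creation_tensor\<close> and
  \<open>creation_e_word\<close>.\<close>

lift_definition creation :: "'j \<Rightarrow> ('j, 'a::complex_inner) fock \<Rightarrow> ('j, 'a) fock"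
  is "\<lambda>j f w. case w of [] \<Rightarrow> 0 | k # v \<Rightarrow> if k = j then f v else 0"
proof -
  fix j :: 'j and f :: "'j list \<Rightarrow> 'a"
  assume f: "square_summable f"
  have "(\<lambda>w. (norm (case w of [] \<Rightarrow> 0 | k # v \<Rightarrow> if k = j then f v else 0))\<^sup>2)
      summable_on range (Cons j)"
    by (subst summable_on_reindex) (use f in \<open>auto simp: square_summable_def o_def\<close>)
  then show "square_summable (\<lambda>w. case w of [] \<Rightarrow> 0 | k # v \<Rightarrow> if k = j then f v else 0)"
    unfolding square_summable_def
    by (rule summable_on_cong_neutral[THEN iffD1, rotated -1]) (auto split: list.splits)
qed

lemma creation_tensor: "creation j (tensor x a) = tensor (creation j x) a"
  by (rule ell2_eqI) (simp add: creation.rep_eq tensor.rep_eq split: list.splits)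

lemma creation_e_word: "creation j (e_word w) = e_word (j # w)"
  by (rule ell2_eqI) (simp add: creation.rep_eq e_word.rep_eq split: list.splits)

lemma cinner_tensor: "cinner (tensor x a) (tensor y b) = cinner x y * cinner a b"
proof -
  have "cinner (tensor x a) (tensor y b)
      = (\<Sum>\<^sub>\<infinity>w. cinner (coord x w) (coord y w) * cinner a b)"
    unfolding cinner_ell2_def tensor.rep_eq
    by (intro infsum_cong)
       (simp add: cinner_scaleC_left cinner_scaleC_right cinner_complex_def mult.assoc)
  also have "\<dots> = cinner x y * cinner a b"
    unfolding cinner_ell2_def by (rule infsum_cmult_left')
  finally show ?thesis .
qed

lemma coord_sum: "coord (sum f F) i = (\<Sum>w\<in>F. coord (f w) i)"
  by (induction F rule: infinite_finite_induct) (auto simp: zero_ell2.rep_eq plus_ell2.rep_eq)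

lemma closed_span_tensor:
  "closed_span (range (\<lambda>(x, a). tensor x a)) = (UNIV :: ('j, 'a::complex_inner) fock set)"
proof -
  have "x \<in> closed_span (range (\<lambda>(x, a). tensor x a))" for x :: "('j, 'a::complex_inner) fock"
    unfolding closed_span_def closure_approachable
  proof (intro allI impI)
    fix e :: real
    assume "e > 0"
    let ?g = "\<lambda>w. (norm (coord x w))\<^sup>2"
    have gs: "?g summable_on UNIV"
      using square_summable_coord[of x] by (simp add: square_summable_def)
    obtain F where F: "finite F" "dist (sum ?g F) (infsum ?g UNIV) \<le> e\<^sup>2 / 2"
      using infsum_finite_approximation[OF gs, of "e\<^sup>2 / 2"] \<open>e > 0\<close> by auto
    define y where "y = (\<Sum>w\<in>F. tensor (e_word w) (coord x w))"
    have y: "coord y w = (if w \<in> F then coord x w else 0)" for w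
    proof -
      have "coord y w = (\<Sum>v\<in>F. if v = w then coord x v else 0)"
        unfolding y_def coord_sum
        by (rule sum.cong) (auto simp: tensor.rep_eq e_word.rep_eq scaleC_one)
      then show ?thesis
        using F(1) by simp
    qed
    have "(norm (y - x))\<^sup>2 = (\<Sum>\<^sub>\<infinity>w. if w \<in> F then 0 else ?g w)"
      unfolding norm_ell2_square by (intro infsum_cong) (simp add: minus_ell2.rep_eq y)
    also have "\<dots> = infsum ?g (UNIV - F)"
      by (rule infsum_cong_neutral) auto
    also have "\<dots> = infsum ?g UNIV - sum ?g F"
      using F(1) gs by (subst infsum_Diff) auto
    also have "\<dots> < e\<^sup>2"
    proof -
      have "e\<^sup>2 > 0" using \<open>e > 0\<close> by simp
      then show ?thesis using F(2) unfolding dist_real_def by linarith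
    qed
    finally have "norm (y - x) < e"
      by (rule power2_less_imp_less) (use \<open>e > 0\<close> in simp)
    then have "dist y x < e"
      by (simp add: dist_norm)
    moreover have "y \<in> complex_vector.span (range (\<lambda>(x, a). tensor x a))"
      unfolding y_def by (intro complex_vector.span_sum complex_vector.span_base) auto
    ultimately show "\<exists>y\<in>complex_vector.span (range (\<lambda>(x, a). tensor x a)). dist y x < e"
      by blast
  qed
  then show ?thesis by blast
qed

section \<open>Multi-analytic operators and their functional model\<close>

definition vacuum_space :: "('j, 'a::complex_inner) fock set" where
  "vacuum_space = range (tensor (e_word []))"

definition multi_analytic ::
    "(('j, 'd::complex_inner) fock \<Rightarrow> ('j, 'l::complex_inner) fock) \<Rightarrow> bool" where
  "multi_analytic M \<longleftrightarrow>
     bounded_clinear M \<and> (\<forall>j x. M (creation j x) = creation j (M x))"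

definition symbol ::
    "(('j, 'd::complex_inner) fock \<Rightarrow> ('j, 'l::complex_inner) fock) \<Rightarrow> 'd \<Rightarrow> ('j, 'l) fock" where
  "symbol M \<delta> = M (tensor (e_word []) \<delta>)"

definition no_constant_directions ::
    "('d::complex_inner \<Rightarrow> ('j, 'l::complex_inner) fock) \<Rightarrow> bool" where
  "no_constant_directions \<Theta> \<longleftrightarrow> (\<forall>\<delta>. \<Theta> \<delta> \<in> vacuum_space \<longrightarrow> \<delta> = 0)"

definition defect ::
    "(('j, 'd::complex_inner) fock \<Rightarrow> ('j, 'l::complex_inner) fock) \<Rightarrow>
     ('j, 'd) fock \<Rightarrow> ('j, 'd) fock" where
  "defect M = sqrt_op (\<lambda>\<xi>. \<xi> - adjoint_on UNIV M (M \<xi>))"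

definition model_space ::
    "(('j, 'd::complex_inner) fock \<Rightarrow> ('j, 'l::complex_inner) fock) \<Rightarrow>
     (('j, 'l) fock \<times> ('j, 'd) fock) set" where
  "model_space M = UNIV \<times> closure (range (defect M))"

text \<open>The two conditions determine \<open>V\<^sub>j\<close> on \<open>model_space M\<close>, since the points \<open>(\<eta>, defect M \<xi>)\<close> are
  dense there. Its values elsewhere are arbitrary and play no role.\<close>

definition model_V ::
    "(('j, 'd::complex_inner) fock \<Rightarrow> ('j, 'l::complex_inner) fock) \<Rightarrow> 'j \<Rightarrow>
     ('j, 'l) fock \<times> ('j, 'd) fock \<Rightarrow> ('j, 'l) fock \<times> ('j, 'd) fock" where
  "model_V M j = (SOME V. continuous_on (model_space M) V \<and>
     (\<forall>\<eta> \<xi>. V (\<eta>, defect M \<xi>) = (creation j \<eta>, defect M (creation j \<xi>))))"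

definition model_HD ::
    "(('j, 'd::complex_inner) fock \<Rightarrow> ('j, 'l::complex_inner) fock) \<Rightarrow>
     (('j, 'l) fock \<times> ('j, 'd) fock) set" where
  "model_HD M = range (\<lambda>\<xi>. (M \<xi>, defect M \<xi>))"

text \<open>The kernel of the adjoint of the row \<open>(V\<^sub>1|HD, \<dots>, V\<^sub>d|HD)\<close>, i.e. the intersection of the kernels
  of the adjoints of its entries.\<close>

definition ker_VD_adj ::
    "(('j, 'd::complex_inner) fock \<Rightarrow> ('j, 'l::complex_inner) fock) \<Rightarrow>
     (('j, 'l) fock \<times> ('j, 'd) fock) set" where
  "ker_VD_adj M = (\<Inter>j. {y \<in> model_HD M. adjoint_on (model_HD M) (model_V M j) y = 0})"

definition model_HA ::
    "(('j, 'd::complex_inner) fock \<Rightarrow> ('j, 'l::complex_inner) fock) \<Rightarrow>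
     (('j, 'l) fock \<times> ('j, 'd) fock) set" where
  "model_HA M = model_space M \<ominus> model_HD M"

definition model_LA ::
    "(('j, 'd::complex_inner) fock \<Rightarrow> ('j, 'l::complex_inner) fock) \<Rightarrow>
     (('j, 'l) fock \<times> ('j, 'd) fock) set" where
  "model_LA M = closed_span (model_HA M \<union> (\<Union>j. model_V M j ` model_HA M)) \<ominus> model_HA M"

definition model_LE ::
    "(('j, 'd::complex_inner) fock \<Rightarrow> ('j, 'l::complex_inner) fock) \<Rightarrow>
     (('j, 'l) fock \<times> ('j, 'd) fock) set" where
  "model_LE M =
     closed_span (model_LA M \<union> orth_proj (model_HD M) ` (vacuum_space \<times> {0}))"

end

theory Submission
  imports Defs
begin

text \<open>Since the defect operator \<open>\<Delta>\<close> satisfies \<open>\<Delta>\<^sup>2 = I - M\<^sup>*M\<close>, the map \<open>W \<xi> = (M \<xi>, \<Delta> \<xi>)\<close> is an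
  isometry onto \<open>HD\<close> that intertwines the creation operators with the \<open>V\<^sub>j\<close>, and \<open>W W\<^sup>*\<close> is the
  orthogonal projection onto \<open>HD\<close>. Hence the kernel of the adjoint of the row is
  \<open>E = {W v | v vacuum}\<close>, and \<open>LA \<subseteq> LE \<subseteq> E\<close>. For \<open>v = e\<^sub>\<emptyset> \<otimes> \<delta>\<close> the vector \<open>W v\<close> is
  orthogonal to \<open>LA\<close> iff \<open>\<Theta> \<delta>\<close> lies in the vacuum space, and orthogonal to \<open>LE\<close> iff \<open>\<Theta> \<delta> = 0\<close>.
  Each of the three equivalences compares two of these orthogonal complements inside \<open>E\<close>.\<close>

section \<open>Closed subspaces and adjoints\<close>

text \<open>A minimizing sequence for the distance from \<open>x\<close> to \<open>A\<close> is
  Cauchy by the parallelogram law, and its limit, the nearest point, has a residual orthogonal to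
  \<open>A\<close>.\<close>

lemma orthogonal_projection_exists:
  fixes A :: "'a::{real_inner,complete_space} set"
  assumes A: "subspace A" "closed A"
  obtains y where "y \<in> A" "\<And>z. z \<in> A \<Longrightarrow> inner (x - y) z = 0"
proof -
  define D where "D = Inf ((\<lambda>a. (norm (x - a))\<^sup>2) ` A)"
  have ne: "(\<lambda>a. (norm (x - a))\<^sup>2) ` A \<noteq> {}"
    using subspace_0[OF A(1)] by blast
  have D_le: "D \<le> (norm (x - a))\<^sup>2" if "a \<in> A" for a
    unfolding D_def by (rule cINF_lower) (use that in \<open>auto intro!: bdd_belowI2[where m = 0]\<close>)
  have "\<exists>a\<in>A. (norm (x - a))\<^sup>2 < D + inverse (real (Suc n))" for n
    using cInf_lessD[OF ne, of "D + inverse (real (Suc n))"] unfolding D_def by auto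
  then obtain a where a: "\<And>n. a n \<in> A" "\<And>n. (norm (x - a n))\<^sup>2 < D + inverse (real (Suc n))"
    by metis
  have dist_a: "(norm (a m - a n))\<^sup>2 \<le> 2 * inverse (real (Suc m)) + 2 * inverse (real (Suc n))" for m n
  proof -
    \<comment> \<open>The midpoint lies in \<open>A\<close>, so its squared distance to
      \<open>x\<close> is at least \<open>D\<close>; this bounds the sum term in the parallelogram
      identity from below.\<close>
    have "(1/2) *\<^sub>R (a m + a n) \<in> A"
      using a A(1) by (intro subspace_scale subspace_add)
    from D_le[OF this] have "4 * D \<le> 4 * (norm (x - (1/2) *\<^sub>R (a m + a n)))\<^sup>2"
      by simp
    also have "\<dots> = (norm (2 *\<^sub>R (x - (1/2) *\<^sub>R (a m + a n))))\<^sup>2"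
      by (simp add: power_mult_distrib)
    also have "2 *\<^sub>R (x - (1/2) *\<^sub>R (a m + a n)) = (x - a m) + (x - a n)"
      by (simp add: algebra_simps scaleR_2)
    finally have "4 * D \<le> (norm ((x - a m) + (x - a n)))\<^sup>2" .
    moreover have "(norm ((x - a m) + (x - a n)))\<^sup>2 + (norm (a m - a n))\<^sup>2
        = 2 * (norm (x - a m))\<^sup>2 + 2 * (norm (x - a n))\<^sup>2"
      unfolding power2_norm_eq_inner by (simp add: inner_diff inner_add inner_commute)
    ultimately show ?thesis
      using a(2)[of m] a(2)[of n] by linarith
  qed
  have "Cauchy a"
    unfolding Cauchy_def
  proof (intro allI impI)
    fix e :: real assume "e > 0"
    then obtain N where N: "inverse (real (Suc N)) < e\<^sup>2 / 4"
      using reals_Archimedean[of "e\<^sup>2 / 4"] by auto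
    show "\<exists>N. \<forall>m\<ge>N. \<forall>n\<ge>N. dist (a m) (a n) < e"
    proof (intro exI[of _ N] allI impI)
      fix m n assume mn: "m \<ge> N" "n \<ge> N"
      then have "inverse (real (Suc m)) \<le> inverse (real (Suc N))"
        "inverse (real (Suc n)) \<le> inverse (real (Suc N))"
        by (simp_all add: field_simps)
      then have "(norm (a m - a n))\<^sup>2 < e\<^sup>2"
        using dist_a[of m n] N by linarith
      then show "dist (a m) (a n) < e"
        using \<open>e > 0\<close> by (simp add: dist_norm power2_less_imp_less)
    qed
  qed
  then obtain y where y: "a \<longlonglongrightarrow> y"
    using Cauchy_convergent_iff convergent_def by blast
  have yA: "y \<in> A"
    using closed_sequentially[OF A(2)] a(1) y by blast
  have "(norm (x - y))\<^sup>2 \<le> D + 0"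
  proof (rule LIMSEQ_le)
    show "(\<lambda>n. (norm (x - a n))\<^sup>2) \<longlonglongrightarrow> (norm (x - y))\<^sup>2"
      by (intro tendsto_intros y)
    show "(\<lambda>n. D + inverse (real (Suc n))) \<longlonglongrightarrow> D + 0"
      by (intro tendsto_intros LIMSEQ_inverse_real_of_nat)
  qed (use a(2) less_imp_le in blast)
  then have le: "(norm (x - y))\<^sup>2 \<le> (norm (x - w))\<^sup>2" if "w \<in> A" for w
    using D_le[OF that] by linarith
  have "inner (x - y) z = 0" if z: "z \<in> A" for z
  proof (cases "z = 0")
    case False
    \<comment> \<open>This \<open>t\<close> minimizes the distance from \<open>x\<close> to the line
      through \<open>y\<close> in direction \<open>z\<close>; a nonzero inner product would bring
      the line closer than \<open>y\<close>.\<close>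
    define t where "t = inner (x - y) z / inner z z"
    have zz: "inner z z > 0" using False by simp
    have "y + t *\<^sub>R z \<in> A"
      using A(1) yA z by (intro subspace_add subspace_scale)
    from le[OF this] have "0 \<le> - 2 * t * inner (x - y) z + t * t * inner z z"
      unfolding power2_norm_eq_inner
      by (simp add: inner_diff inner_add inner_commute algebra_simps)
    also have "\<dots> = - (inner (x - y) z)\<^sup>2 / inner z z"
      using zz by (simp add: t_def field_simps power2_eq_square)
    finally show ?thesis
      using zz by (simp add: divide_le_0_iff zero_le_divide_iff)
  qed simp
  with yA show thesis by (rule that)
qed

definition closed_csubspace :: "'a::complex_inner set \<Rightarrow> bool" where
  "closed_csubspace A \<longleftrightarrow> complex_vector.subspace A \<and> closed A"

lemma csubspace_imp_subspace: "complex_vector.subspace A \<Longrightarrow> subspace A"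
  by (simp add: subspace_def complex_vector.subspace_def scaleR_eq_scaleC)

text \<open>Real orthogonality to both \<open>z\<close> and its multiple by the imaginary unit kills
  the real and imaginary parts of the complex inner product.\<close>

lemma closed_csubspace_projection_exists:
  fixes A :: "'a::chilbert_space set"
  assumes A: "closed_csubspace A"
  obtains y where "y \<in> A" "\<And>z. z \<in> A \<Longrightarrow> cinner (x - y) z = 0"
proof -
  have s: "complex_vector.subspace A" using A by (simp add: closed_csubspace_def)
  then obtain y where y: "y \<in> A" "\<And>z. z \<in> A \<Longrightarrow> inner (x - y) z = 0"
    using orthogonal_projection_exists[of A x] A csubspace_imp_subspace 
    by (auto simp: closed_csubspace_def)
  have "cinner (x - y) z = 0" if "z \<in> A" for z
  proof -
    have "\<i> *\<^sub>C z \<in> A" using s that by (rule complex_vector.subspace_scale)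
    with y(2)[OF this] y(2)[OF that] show ?thesis
      by (simp add: inner_eq_Re_cinner cinner_scaleC_right complex_eq_iff)
  qed
  with y(1) show thesis by (rule that)
qed

text \<open>The residual of a point of \<open>B\<close> after projection onto \<open>A\<close> stays
  in \<open>B\<close> and is orthogonal to \<open>A\<close>, hence vanishes.\<close>

lemma closed_csubspace_eqI:
  fixes A :: "'a::chilbert_space set"
  assumes A: "closed_csubspace A" and B: "complex_vector.subspace B" and "A \<subseteq> B"
    and orth: "\<And>y. y \<in> B \<Longrightarrow> (\<And>z. z \<in> A \<Longrightarrow> cinner y z = 0) \<Longrightarrow> y = 0"
  shows "A = B"
proof
  show "B \<subseteq> A"
  proof
    fix x assume x: "x \<in> B"
    obtain y where y: "y \<in> A" "\<And>z. z \<in> A \<Longrightarrow> cinner (x - y) z = 0"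
      using closed_csubspace_projection_exists[OF A] by blast
    have "x - y \<in> B"
      using B x y(1) \<open>A \<subseteq> B\<close> by (intro complex_vector.subspace_diff) auto
    with orth y(2) have "x - y = 0" by blast
    with y(1) show "x \<in> A" by simp
  qed
qed fact

lemma cinner_eq_zero_iff: "cinner x x = 0 \<longleftrightarrow> x = (0::'a::complex_inner)"
  by (simp add: cinner_self)

lemma norm_eq_if_cinner_eq:
  "cinner x x = cinner y y \<Longrightarrow> norm x = norm y" for x :: "'a::complex_inner" and y :: "'b::complex_inner"
  unfolding cinner_self of_real_eq_iff by (simp add: power2_eq_iff_nonneg)

lemma cinner_diff_left: "cinner (x - y) z = cinner x z - cinner y (z::'a::complex_inner)"
  using cinner_add_left[of "x - y" y z] by simp

lemma cinner_diff_right: "cinner z (x - y) = cinner z x - cinner z (y::'a::complex_inner)"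
  using cinner_add_right[of z "x - y" y] by simp

lemma cinner_ext: "(\<And>z. cinner z x = cinner z y) \<Longrightarrow> x = (y::'a::complex_inner)"
  using cinner_eq_zero_iff[of "x - y"] by (simp add: cinner_diff_right)

lemma cinner_eq_zero_sym: "cinner x y = 0 \<longleftrightarrow> cinner y (x::'a::complex_inner) = 0"
  using cinner_commute[of x y] by auto

lemma bounded_bilinear_cinner: "bounded_bilinear (cinner :: 'a::complex_inner \<Rightarrow> 'a \<Rightarrow> complex)"
  by unfold_locales
     (auto simp: cinner_add_left cinner_add_right scaleR_eq_scaleC cinner_scaleC_left
       cinner_scaleC_right scaleC_complex_def intro!: exI[of _ 1] norm_cinner_le)

lemmas continuous_on_cinner = bounded_bilinear.continuous_on[OF bounded_bilinear_cinner]

lemma bounded_linear_scaleC: "bounded_linear (\<lambda>x::'a::complex_inner. c *\<^sub>C x)"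
  by (rule bounded_linear_intro[where K = "norm c"])
     (auto simp: scaleC_add_right scaleR_eq_scaleC norm_scaleC mult.commute scaleC_scaleC)

lemma bounded_clinearD:
  assumes "bounded_clinear T"
  shows "bounded_linear T" "T (x + y) = T x + T y" "T (x - y) = T x - T y" "T (c *\<^sub>C x) = c *\<^sub>C T x" "T 0 = 0"
  using assms linear_simps[of T]
  by (auto simp: bounded_clinear_def)

lemma closed_csubspace_orth_diff:
  fixes A :: "'a::complex_inner set"
  assumes "closed_csubspace A"
  shows "closed_csubspace (A \<ominus> B)"
proof -
  have eq: "A \<ominus> B = A \<inter> (\<Inter>y\<in>B. {x. cinner x y = 0})"
    by (auto simp: orth_diff_def)
  have "closed (A \<ominus> B)"
    unfolding eq using assms
    by (intro closed_Int closed_INT ballI closed_Collect_eq continuous_on_cinner continuous_intros)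
       (simp add: closed_csubspace_def)
  moreover have "complex_vector.subspace (A \<ominus> B)"
    using assms unfolding closed_csubspace_def complex_vector.subspace_def orth_diff_def
    by (auto simp: cinner_zero_left cinner_add_left cinner_scaleC_left)
  ultimately show ?thesis by (simp add: closed_csubspace_def)
qed

lemma closed_csubspace_closed_span: "closed_csubspace (closed_span S)"
proof -
  let ?T = "complex_vector.span S"
  have T: "complex_vector.subspace ?T" by simp
  have "c *\<^sub>C x \<in> closure ?T" if "x \<in> closure ?T" for c x
  proof -
    have "c *\<^sub>C x \<in> closure ((*\<^sub>C) c ` ?T)"
      using closure_bounded_linear_image_subset[OF bounded_linear_scaleC, of c ?T] that by blast
    also have "\<dots> \<subseteq> closure ?T"
      using T by (intro closure_mono) (auto intro: complex_vector.subspace_scale)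
    finally show ?thesis .
  qed
  moreover have "x + y \<in> closure ?T" if xy: "x \<in> closure ?T" "y \<in> closure ?T" for x y
  proof -
    obtain X Y where "\<And>n. X n \<in> ?T" "X \<longlonglongrightarrow> x" "\<And>n. Y n \<in> ?T" "Y \<longlonglongrightarrow> y"
      using xy unfolding closure_sequential by blast
    then show ?thesis
      unfolding closure_sequential
      by (intro exI[of _ "\<lambda>n. X n + Y n"]) (auto intro: tendsto_add complex_vector.subspace_add[OF T])
  qed
  moreover have "0 \<in> closure ?T"
    using complex_vector.subspace_0[OF T] closure_subset by blast
  ultimately show ?thesis
    by (simp add: closed_csubspace_def closed_span_def complex_vector.subspace_def)
qed

lemma closed_span_superset: "S \<subseteq> closed_span S"
  unfolding closed_span_def using complex_vector.span_superset closure_subset by blast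

lemma closed_span_minimal: "S \<subseteq> A \<Longrightarrow> closed_csubspace A \<Longrightarrow> closed_span S \<subseteq> A"
  unfolding closed_span_def closed_csubspace_def
  by (intro closure_minimal complex_vector.span_minimal) auto

lemma closed_csubspace_UNIV: "closed_csubspace UNIV"
  by (simp add: closed_csubspace_def)

text \<open>The vectors orthogonal to \<open>y\<close> form a closed subspace, so it suffices to
  test generators.\<close>

lemma orth_closed_span:
  assumes "\<And>x. x \<in> S \<Longrightarrow> cinner x y = 0" "x \<in> closed_span S"
  shows "cinner x y = 0"
  using closed_span_minimal[of S "UNIV \<ominus> {y}"] closed_csubspace_orth_diff[OF closed_csubspace_UNIV, of "{y}"] assms
  by (auto simp: orth_diff_def)

section \<open>Riesz representation, adjoints and symmetry of positive operators\<close>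

text \<open>The kernel of a nonzero \<open>f\<close> is closed and has an orthogonal vector
  \<open>u\<close> with \<open>f u\<close> nonzero. Every \<open>v\<close> is a multiple of
  \<open>u\<close> modulo the kernel, so a multiple of \<open>u\<close> represents
  \<open>f\<close>.\<close>

lemma Riesz_representation:
  fixes f :: "'a::chilbert_space \<Rightarrow> complex"
  assumes f: "bounded_clinear f"
  obtains z where "\<And>x. f x = cinner x z"
proof (cases "\<forall>x. f x = 0")
  case True
  then show ?thesis using that[of 0] by (simp add: cinner_zero_right)
next
  case False
  then obtain x where x: "f x \<noteq> 0" by blast
  note lin = bounded_clinearD[OF f]
  have "closed_csubspace {v. f v = 0}"
    unfolding closed_csubspace_def complex_vector.subspace_def
    using lin by (auto simp: scaleC_complex_def intro!: closed_Collect_eq linear_continuous_on)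
  then obtain p where p: "f p = 0" "\<And>v. f v = 0 \<Longrightarrow> cinner (x - p) v = 0"
    using closed_csubspace_projection_exists[of "{v. f v = 0}" x] by auto
  define u where "u = x - p"
  have fu: "f u \<noteq> 0" using x p(1) by (simp add: u_def lin)
  then have uu: "cinner u u \<noteq> 0" using lin(5) by (auto simp: cinner_eq_zero_iff)
  have "f v = cinner v ((cnj (f u) / cnj (cinner u u)) *\<^sub>C u)" for v
  proof -
    have "f (v - (f v / f u) *\<^sub>C u) = 0"
      using fu by (simp add: lin scaleC_complex_def)
    then have "cinner (v - (f v / f u) *\<^sub>C u) u = 0"
      using p(2) cinner_eq_zero_sym unfolding u_def by blast
    then have "cinner v u = f v / f u * cinner u u"
      by (simp add: cinner_diff_left cinner_scaleC_left)
    then show ?thesis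
      using fu uu by (simp add: cinner_scaleC_right)
  qed
  then show ?thesis by (rule that)
qed

lemma bounded_clinear_cinner_left: "bounded_clinear T \<Longrightarrow> bounded_clinear (\<lambda>x. cinner (T x) y)"
  using bounded_linear_compose[OF bounded_bilinear.bounded_linear_left[OF bounded_bilinear_cinner], of T y]
  by (simp add: bounded_clinear_def cinner_scaleC_left scaleC_complex_def)

text \<open>Riesz representation gives existence and \<open>cinner_ext\<close> uniqueness, so the
  definite description in \<open>adjoint_on\<close> is well defined.\<close>

lemma cinner_adjoint:
  fixes T :: "'a::chilbert_space \<Rightarrow> 'b::complex_inner"
  assumes "bounded_clinear T"
  shows "cinner (T x) y = cinner x (adjoint_on UNIV T y)"
proof -
  obtain z where z: "\<And>x. cinner (T x) y = cinner x z"
    using Riesz_representation[OF bounded_clinear_cinner_left[OF assms]] by blast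
  then have "adjoint_on UNIV T y = z"
    unfolding adjoint_on_def by (intro the_equality) (auto intro: cinner_ext)
  with z show ?thesis by simp
qed

lemma cinner_adjoint':
  fixes T :: "'a::chilbert_space \<Rightarrow> 'b::complex_inner"
  assumes "bounded_clinear T"
  shows "cinner y (T x) = cinner (adjoint_on UNIV T y) x"
  using cinner_adjoint[OF assms, of x y] cinner_commute[of y "T x"] 
    cinner_commute[of _ x] by metis

lemma norm_adjoint_le:
  fixes T :: "'a::chilbert_space \<Rightarrow> 'b::complex_inner"
  assumes T: "bounded_clinear T" and le: "\<And>x. norm (T x) \<le> norm x"
  shows "norm (adjoint_on UNIV T y) \<le> norm y"
proof (cases "adjoint_on UNIV T y = 0")
  case False
  let ?z = "adjoint_on UNIV T y"
  have "norm ?z * norm ?z = norm (cinner ?z ?z)"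
    by (simp add: cinner_self power2_eq_square norm_mult)
  also have "cinner ?z ?z = cinner (T ?z) y"
    by (rule cinner_adjoint[OF T, symmetric])
  also have "norm \<dots> \<le> norm (T ?z) * norm y"
    by (rule norm_cinner_le)
  also have "\<dots> \<le> norm ?z * norm y"
    by (intro mult_right_mono le) simp
  finally show ?thesis using False by simp
qed simp

lemma bounded_clinear_adjoint:
  fixes T :: "'a::chilbert_space \<Rightarrow> 'b::complex_inner"
  assumes T: "bounded_clinear T" and le: "\<And>x. norm (T x) \<le> norm x"
  shows "bounded_clinear (adjoint_on UNIV T)"
proof -
  note adj = cinner_adjoint[OF T, symmetric]
  have sc: "adjoint_on UNIV T (c *\<^sub>C y) = c *\<^sub>C adjoint_on UNIV T y" for c y
    by (rule cinner_ext) (simp add: adj cinner_scaleC_right)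
  have "bounded_linear (adjoint_on UNIV T)"
  proof (rule bounded_linear_intro[where K = 1])
    show "adjoint_on UNIV T (x + y) = adjoint_on UNIV T x + adjoint_on UNIV T y" for x y
      by (rule cinner_ext) (simp add: adj cinner_add_right)
  qed (auto simp: scaleR_eq_scaleC sc norm_adjoint_le[OF T le])
  with sc show ?thesis by (simp add: bounded_clinear_def)
qed

text \<open>Polarization: the quadratic form is real at \<open>x + y\<close> and at
  \<open>x + \<i> *\<^sub>C y\<close>, which settles the imaginary and the real part
  respectively.\<close>

lemma positive_op_symmetric:
  assumes "positive_op T"
  shows "cinner (T x) y = cinner x (T y)"
proof -
  have T: "bounded_clinear T" using assms by (simp add: positive_op_def)
  have Im: "Im (cinner (T z) z) = 0" for z
    using assms by (auto simp: positive_op_def complex_nonneg_Reals_iff)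
  have "Im (cinner (T x) y + cinner (T y) x) = 0"
    using Im[of "x + y"] Im[of x] Im[of y]
    by (simp add: bounded_clinearD[OF T] cinner_add_left cinner_add_right)
  moreover have "Re (cinner (T x) y) = Re (cinner (T y) x)"
    using Im[of "x + \<i> *\<^sub>C y"] Im[of x] Im[of y]
    by (simp add: bounded_clinearD[OF T] cinner_add_left cinner_add_right cinner_scaleC_left cinner_scaleC_right)
  moreover have "cinner x (T y) = cnj (cinner (T y) x)"
    by (rule cinner_commute)
  ultimately show ?thesis
    by (simp add: complex_eq_iff)
qed

section \<open>Square roots of positive operators\<close>

instance chilbert_space \<subseteq> banach ..

text \<open>The Taylor coefficients of \<open>sqrt (1 - x)\<close>. All but the first are nonpositive and their partial
  sums are nonnegative, so that the series converges absolutely also for contractions.\<close>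

definition sqrt_coeff :: "nat \<Rightarrow> real" where
  "sqrt_coeff n = ((1 / 2) gchoose n) * (- 1) ^ n"

lemma gchoose_Suc_ratio: "a gchoose Suc n = (a gchoose n) * ((a - real n) / real (Suc n))" for a :: real
  using gbinomial_mult_1[of a n] by (simp add: field_simps)

lemma sqrt_coeff_0: "sqrt_coeff 0 = 1"
  by (simp add: sqrt_coeff_def)

text \<open>The coefficient of index 1 is -1/2, and all later quotients of consecutive coefficients
  are positive.\<close>

lemma sqrt_coeff_Suc_nonpos: "sqrt_coeff (Suc n) \<le> 0"
proof (induction n)
  case (Suc n)
  have "sqrt_coeff (Suc (Suc n)) = sqrt_coeff (Suc n) * ((real (Suc n) - 1/2) / real (Suc (Suc n)))"
    unfolding sqrt_coeff_def gchoose_Suc_ratio[of _ "Suc n"] by (simp add: field_simps)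
  then show ?case
    by (simp only: mult_nonpos_nonneg[OF Suc] divide_nonneg_nonneg)
qed (simp add: sqrt_coeff_def)

text \<open>The partial sum telescopes to \<open>(- 1) ^ n * (- (1/2) gchoose n)\<close>, and the
  sign cancels the alternation of the binomial coefficient.\<close>

lemma sum_sqrt_coeff_nonneg: "0 \<le> (\<Sum>k\<le>n. sqrt_coeff k)"
proof -
  have "0 \<le> (- 1) ^ m * ((- (1/2) :: real) gchoose m)" for m :: nat
  proof (induction m)
    case (Suc m)
    have "(- 1) ^ Suc m * ((- (1/2) :: real) gchoose Suc m)
        = ((- 1) ^ m * (- (1/2) gchoose m)) * ((real m + 1/2) / real (Suc m))"
      unfolding gchoose_Suc_ratio[of _ m] by (simp add: field_simps)
    then show ?case
      using Suc by simp
  qed simp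
  then show ?thesis
    using gbinomial_sum_lower_neg[of "1/2 :: real" n] by (simp add: sqrt_coeff_def)
qed

text \<open>Only the coefficient 1 at index 0 is positive, so a nonempty sum of absolute values is 2
  minus the corresponding sum of coefficients.\<close>

lemma sum_abs_sqrt_coeff_le: "(\<Sum>k<n. \<bar>sqrt_coeff k\<bar>) \<le> 2"
proof (cases n)
  case (Suc m)
  have "\<bar>sqrt_coeff k\<bar> = - sqrt_coeff k + (if k = 0 then 2 else 0)" for k
    using sqrt_coeff_Suc_nonpos[of "k - 1"] by (cases k) (auto simp: sqrt_coeff_0)
  then have "(\<Sum>k\<le>m. \<bar>sqrt_coeff k\<bar>) = (\<Sum>k\<le>m. - sqrt_coeff k + (if k = 0 then 2 else 0))"
    by (intro sum.cong refl)
  also have "\<dots> = - (\<Sum>k\<le>m. sqrt_coeff k) + 2"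
    unfolding sum.distrib sum_negf by simp
  finally have "(\<Sum>k\<le>m. \<bar>sqrt_coeff k\<bar>) = - (\<Sum>k\<le>m. sqrt_coeff k) + 2" .
  then show ?thesis
    using sum_sqrt_coeff_nonneg[of m] by (simp add: Suc lessThan_Suc_atMost)
qed simp

lemma summable_abs_sqrt_coeff: "summable (\<lambda>k. \<bar>sqrt_coeff k\<bar>)"
  by (rule bounded_imp_summable[where B = 2])
     (simp_all add: lessThan_Suc_atMost[symmetric] sum_abs_sqrt_coeff_le del: sum.lessThan_Suc)

text \<open>Vandermonde's identity turns the convolution into the coefficients of 1 - x, which says
  that the series squares to 1 - x.\<close>

lemma sqrt_coeff_convolution:
  "(\<Sum>k\<le>n. sqrt_coeff k * sqrt_coeff (n - k)) = (if n = 0 then 1 else if n = 1 then - 1 else 0)"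
proof -
  have "(\<Sum>k\<le>n. sqrt_coeff k * sqrt_coeff (n - k))
      = (- 1) ^ n * (\<Sum>k = 0..n. ((1/2) gchoose k) * ((1/2) gchoose (n - k)))"
    unfolding sum_distrib_left atLeast0AtMost
    by (intro sum.cong) (auto simp: sqrt_coeff_def power_add[symmetric])
  also have "\<dots> = (- 1) ^ n * (1 gchoose n)"
    by (simp add: gbinomial_Vandermonde)
  also have "(1::real) gchoose n = of_nat (1 choose n)"
    by (simp add: binomial_gbinomial)
  finally show ?thesis
    by (cases n rule: nat.exhaust; cases "n - 1") (auto simp: binomial_eq_0)
qed

text \<open>The root is the binomial series of sqrt(1 - x) evaluated at \<open>R\<close>; it
  converges absolutely because the powers of \<open>R\<close> are contractions.\<close>

lemma exists_positive_sqrt: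
  fixes R :: "'a::chilbert_space \<Rightarrow> 'a"
  assumes R: "bounded_clinear R" and R_le: "\<And>x. norm (R x) \<le> norm x"
    and R_sym: "\<And>x y. cinner (R x) y = cinner x (R y)"
  shows "\<exists>S. positive_op S \<and> S \<circ> S = (\<lambda>x. x - R x)"
proof -
  let ?a = sqrt_coeff
  define S where "S x = (\<Sum>n. ?a n *\<^sub>R (R ^^ n) x)" for x
  have Rn: "bounded_clinear (R ^^ n)" for n
  proof (induction n)
    case (Suc n)
    then show ?case using R bounded_linear_compose[of R "R ^^ n"] 
      by (simp add: bounded_clinear_def comp_def)
  qed (simp add: bounded_clinear_def)
  note Rn_lin = bounded_clinearD[OF Rn]
  have Rn_le: "norm ((R ^^ n) x) \<le> norm x" for n x
    by (induction n) (auto intro: order_trans[OF R_le])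
  have Rn_sym: "cinner ((R ^^ n) x) y = cinner x ((R ^^ n) y)" for n x y
    by (induction n arbitrary: x y) (simp_all add: R_sym funpow_swap1)
  have norm_term: "norm (?a n *\<^sub>R (R ^^ n) x) \<le> \<bar>?a n\<bar> * norm x" for n x
    by (simp add: Rn_le mult_left_mono)
  have sm_norm: "summable (\<lambda>n. \<bar>?a n\<bar> * norm x)" for x :: 'a
    by (intro summable_mult2 summable_abs_sqrt_coeff)
  have sm: "summable (\<lambda>n. ?a n *\<^sub>R (R ^^ n) x)" for x
    by (rule summable_comparison_test'[OF sm_norm[of x]]) (rule norm_term)
  have S_sums: "(\<lambda>n. ?a n *\<^sub>R (R ^^ n) x) sums S x" for x
    unfolding S_def using sm by (rule summable_sums)
  have S_add: "S (x + y) = S x + S y" for x y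
    unfolding S_def by (simp add: Rn_lin scaleR_add_right suminf_add[OF sm sm])
  have S_scaleC: "S (c *\<^sub>C x) = c *\<^sub>C S x" for c x
  proof -
    have "(\<lambda>n. c *\<^sub>C (?a n *\<^sub>R (R ^^ n) x)) sums (c *\<^sub>C S x)"
      by (rule bounded_linear.sums[OF bounded_linear_scaleC S_sums])
    moreover have "c *\<^sub>C (?a n *\<^sub>R (R ^^ n) x) = ?a n *\<^sub>R (R ^^ n) (c *\<^sub>C x)" for n
      by (simp add: Rn_lin scaleR_eq_scaleC scaleC_scaleC mult.commute)
    ultimately have "(\<lambda>n. ?a n *\<^sub>R (R ^^ n) (c *\<^sub>C x)) sums (c *\<^sub>C S x)"
      by (simp only:)
    with S_sums show ?thesis
      by (rule sums_unique2)
  qed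
  have S: "bounded_clinear S"
    unfolding bounded_clinear_def
  proof
    show "bounded_linear S"
    proof (rule bounded_linear_intro[where K = "\<Sum>n. \<bar>?a n\<bar>"])
      fix x
      have "norm (S x) \<le> (\<Sum>n. \<bar>?a n\<bar> * norm x)"
        unfolding S_def by (rule norm_suminf_le[OF norm_term sm_norm])
      then show "norm (S x) \<le> norm x * (\<Sum>n. \<bar>?a n\<bar>)"
        by (simp add: suminf_mult2[OF summable_abs_sqrt_coeff, symmetric] mult.commute[of "norm x"])
    qed (simp_all add: S_add S_scaleC scaleR_eq_scaleC)
  qed (simp add: S_scaleC)
  have "cinner (S x) x \<in> \<real>\<^sub>\<ge>\<^sub>0" for x
  proof -
    \<comment> \<open>These moments of \<open>R\<close> at \<open>x\<close> are real by symmetry and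
      at most \<open>r 0\<close> by contractivity.\<close>
    define r where "r n = inner ((R ^^ n) x) x" for n
    have "cnj (cinner ((R ^^ n) x) x) = cinner ((R ^^ n) x) x" for n
      using Rn_sym[of n x x] cinner_commute by metis
    then have rn: "cinner ((R ^^ n) x) x = of_real (r n)" for n
      unfolding r_def inner_eq_Re_cinner by (simp add: complex_eq_iff)
    have r_le: "r n \<le> r 0" for n
    proof -
      have "r n \<le> norm ((R ^^ n) x) * norm x"
        unfolding r_def by (rule norm_cauchy_schwarz)
      also have "\<dots> \<le> norm x * norm x"
        by (intro mult_right_mono Rn_le) simp
      finally show ?thesis
        by (simp add: r_def dot_square_norm power2_eq_square)
    qed
    have "(\<lambda>n. cinner (?a n *\<^sub>R (R ^^ n) x) x) sums cinner (S x) x"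
      by (rule bounded_linear.sums[OF bounded_bilinear.bounded_linear_left[OF bounded_bilinear_cinner] S_sums])
    then have sums: "(\<lambda>n. complex_of_real (?a n * r n)) sums cinner (S x) x"
      by (simp add: scaleR_eq_scaleC cinner_scaleC_left rn)
    have Im0: "Im (cinner (S x) x) = 0"
      using sums_unique2[OF sums_Im[OF sums], of 0] by simp
    have "0 \<le> Re (cinner (S x) x)"
    proof (rule LIMSEQ_le_const)
      show "(\<lambda>n. \<Sum>k<n. ?a k * r k) \<longlonglongrightarrow> Re (cinner (S x) x)"
        using sums_Re[OF sums] by (simp add: sums_def)
      show "\<exists>N. \<forall>n\<ge>N. 0 \<le> (\<Sum>k<n. ?a k * r k)"
      proof (intro exI[of _ 1] allI impI)
        fix n :: nat assume "n \<ge> 1"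
        \<comment> \<open>The coefficients after the first are nonpositive, so replacing each
          \<open>r k\<close> by the larger \<open>r 0\<close> only lowers the sum. What remains is a
          nonnegative partial sum times \<open>r 0\<close>.\<close>
        have "0 \<le> (\<Sum>k<n. ?a k) * r 0"
          using sum_sqrt_coeff_nonneg[of "n - 1"] \<open>n \<ge> 1\<close>
          by (cases n) (auto simp: r_def lessThan_Suc_atMost)
        also have "\<dots> \<le> (\<Sum>k<n. ?a k * r k)"
          unfolding sum_distrib_right
        proof (rule sum_mono)
          fix k
          show "?a k * r 0 \<le> ?a k * r k"
            using sqrt_coeff_Suc_nonpos[of "k - 1"] r_le[of k]
            by (cases k) (auto intro: mult_left_mono_neg)
        qed
        finally show "0 \<le> (\<Sum>k<n. ?a k * r k)" .
      qed
    qed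
    with Im0 show ?thesis
      by (simp add: complex_nonneg_Reals_iff)
  qed
  with S have "positive_op S"
    by (simp add: positive_op_def)
  moreover have "S (S x) = x - R x" for x
  proof -
    \<comment> \<open>This absolutely summable double family is summed in two ways: by rows it gives
      \<open>S (S x)\<close>, by antidiagonals the convolution gives \<open>x - R x\<close>.\<close>
    define f where "f j k = (?a j * ?a k) *\<^sub>R (R ^^ (j + k)) x" for j k
    have absa: "(\<lambda>n. \<bar>?a n\<bar>) summable_on UNIV"
      using norm_summable_imp_summable_on[of "\<lambda>n. \<bar>?a n\<bar>"] summable_abs_sqrt_coeff by simp
    have "(\<lambda>p. norm (case p of (j, k) \<Rightarrow> ?a j * (?a k * norm x))) summable_on UNIV \<times> UNIV"
      unfolding Infinite_Sum.abs_summable_on_Sigma_iff using absa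
      by (auto simp: abs_mult infsum_cmult_right' intro!: summable_on_cmult_left summable_on_cmult_right)
    then have "(\<lambda>p. norm (case p of (j, k) \<Rightarrow> f j k)) summable_on UNIV \<times> UNIV"
      by (rule Infinite_Sum.abs_summable_on_comparison_test')
         (auto simp: f_def abs_mult mult.assoc Rn_le intro!: mult_left_mono)
    then have f_sm: "(\<lambda>(j, k). f j k) summable_on UNIV \<times> UNIV"
      by (rule abs_summable_summable)
    then obtain s where s: "((\<lambda>(j, k). f j k) has_sum s) (UNIV \<times> UNIV)"
      by (auto simp: summable_on_def)
    have "(f j has_sum ?a j *\<^sub>R (R ^^ j) (S x)) UNIV" for j
    proof -
      have "(\<lambda>k. ?a j *\<^sub>R (R ^^ j) (?a k *\<^sub>R (R ^^ k) x)) sums (?a j *\<^sub>R (R ^^ j) (S x))"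
        by (intro bounded_linear.sums[OF bounded_linear_scaleR_right] bounded_linear.sums[OF Rn_lin(1)] S_sums)
      moreover have "?a j *\<^sub>R (R ^^ j) (?a k *\<^sub>R (R ^^ k) x) = f j k" for k
        by (simp add: f_def Rn_lin scaleR_eq_scaleC scaleC_scaleC funpow_add)
      ultimately have "f j sums (?a j *\<^sub>R (R ^^ j) (S x))"
        by simp
      moreover have "summable (\<lambda>k. norm (f j k))"
      proof (rule summable_comparison_test')
        show "summable (\<lambda>k. \<bar>?a j\<bar> * (\<bar>?a k\<bar> * norm x))"
          by (intro summable_mult sm_norm)
        show "norm (norm (f j k)) \<le> \<bar>?a j\<bar> * (\<bar>?a k\<bar> * norm x)" for k
          by (simp add: f_def abs_mult mult.assoc Rn_le mult_left_mono)
      qed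
      ultimately show ?thesis
        by (intro norm_summable_imp_has_sum)
    qed
    then have "((\<lambda>j. ?a j *\<^sub>R (R ^^ j) (S x)) has_sum s) UNIV"
      by (intro has_sum_SigmaD[OF s]) simp
    then have "s = S (S x)"
      by (rule sums_unique2[OF has_sum_imp_sums S_sums])
    moreover have "s = x - R x"
    proof -
      have "((\<lambda>(n, k). f k (n - k)) has_sum s) (SIGMA n:UNIV. {..n})"
        using s
        by (rule has_sum_reindex_bij_witness[where i = "\<lambda>(j, k). (j + k, j)"
              and j = "\<lambda>(n, k). (k, n - k)", THEN iffD2, rotated -1]) auto
      then have "((\<lambda>n. \<Sum>k\<le>n. f k (n - k)) has_sum s) UNIV"
        by (rule has_sum_SigmaD) (simp add: has_sum_finite)
      moreover have "(\<Sum>k\<le>n. f k (n - k)) = (if n = 0 then x else if n = 1 then - R x else 0)" for n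
      proof -
        have "(\<Sum>k\<le>n. f k (n - k)) = (\<Sum>k\<le>n. ?a k * ?a (n - k)) *\<^sub>R (R ^^ n) x"
          unfolding scaleR_sum_left by (intro sum.cong) (auto simp: f_def)
        then show ?thesis
          by (simp add: sqrt_coeff_convolution)
      qed
      ultimately have "((\<lambda>n::nat. if n = 0 then x else if n = 1 then - R x else 0) has_sum s) UNIV"
        by simp
      then have "((\<lambda>n::nat. if n = 0 then x else if n = 1 then - R x else 0) has_sum s) {0, 1::nat}"
        by (rule has_sum_cong_neutral[THEN iffD1, rotated -1]) auto
      moreover have "((\<lambda>n::nat. if n = 0 then x else if n = 1 then - R x else 0) has_sum (x - R x)) {0, 1::nat}"
        by (rule has_sum_finiteI) auto
      ultimately show ?thesis
        by (rule has_sum_unique)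
    qed
    ultimately show ?thesis by simp
  qed
  then have "S \<circ> S = (\<lambda>x. x - R x)" by auto
  ultimately show ?thesis by blast
qed

section \<open>Creation and annihilation operators\<close>

text \<open>The adjoint of \<open>creation j\<close>, as \<open>cinner_creation\<close>
  shows.\<close>

lift_definition annihilation :: "'j \<Rightarrow> ('j, 'a::complex_inner) fock \<Rightarrow> ('j, 'a) fock"
  is "\<lambda>j f w. f (j # w)"
proof -
  fix j :: 'j and f :: "'j list \<Rightarrow> 'a"
  assume "square_summable f"
  then have "(\<lambda>w. (norm (f w))\<^sup>2) summable_on range (Cons j)"
    unfolding square_summable_def by (rule summable_on_subset_banach) simp
  then show "square_summable (\<lambda>w. f (j # w))"
    by (subst (asm) summable_on_reindex) (auto simp: square_summable_def o_def)
qed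

lemma cinner_creation: "cinner (creation j f) g = cinner f (annihilation j g)"
proof -
  have "cinner (creation j f) g
      = (\<Sum>\<^sub>\<infinity>w\<in>range (Cons j). cinner (coord (creation j f) w) (coord g w))"
    unfolding cinner_ell2_def
    by (rule infsum_cong_neutral) (auto simp: creation.rep_eq cinner_zero_left split: list.splits)
  also have "\<dots> = cinner f (annihilation j g)"
    by (subst infsum_reindex) (auto simp: cinner_ell2_def creation.rep_eq annihilation.rep_eq o_def)
  finally show ?thesis .
qed

lemma annihilation_creation: "annihilation i (creation j f) = (if i = j then f else 0)"
  by (rule ell2_eqI) (simp add: annihilation.rep_eq creation.rep_eq zero_ell2.rep_eq)

lemma cinner_creation_creation:
  "cinner (creation i f) (creation j g) = (if i = j then cinner f g else 0)"
  by (simp add: cinner_creation annihilation_creation cinner_zero_right)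

lemma bounded_linear_creation: "bounded_linear (creation j)"
proof (rule bounded_linear_intro[where K = 1])
  show "norm (creation j x) \<le> norm x * 1" for x
    by (simp add: norm_eq_if_cinner_eq[of "creation j x" x] cinner_creation_creation)
qed (auto intro!: ell2_eqI simp: creation.rep_eq plus_ell2.rep_eq scaleR_ell2.rep_eq split: list.splits)

lemma coord_vacuum: "coord (tensor (e_word []) a) w = (if w = [] then a else 0)"
  by (simp add: tensor.rep_eq e_word.rep_eq scaleC_one)

text \<open>Every nonempty word has the form \<open>j # w\<close>, so vanishing of all annihilations
  leaves only the coordinate at the empty word. Membership thereby becomes testable by inner
  products with creations.\<close>

lemma vacuum_space_iff: "f \<in> vacuum_space \<longleftrightarrow> (\<forall>j. annihilation j f = 0)"
proof
  assume "f \<in> vacuum_space"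
  then show "\<forall>j. annihilation j f = 0"
    by (auto simp: vacuum_space_def annihilation.rep_eq coord_vacuum zero_ell2.rep_eq intro!: ell2_eqI)
next
  assume *: "\<forall>j. annihilation j f = 0"
  have "coord f (j # w) = 0" for j w
    using arg_cong[OF *[rule_format, of j], of "\<lambda>x. coord x w"]
    by (simp add: annihilation.rep_eq zero_ell2.rep_eq)
  then have "f = tensor (e_word []) (coord f [])"
    by (intro ell2_eqI) (metis coord_vacuum neq_Nil_conv)
  then show "f \<in> vacuum_space"
    unfolding vacuum_space_def by blast
qed

lemma tensor_vacuum_0_iff: "tensor (e_word []) a = 0 \<longleftrightarrow> a = 0"
  by (metis coord_vacuum ell2_eqI zero_ell2.rep_eq)

lemma zero_in_vacuum_space: "0 \<in> vacuum_space"
  using tensor_vacuum_0_iff[of 0] unfolding vacuum_space_def by (metis rangeI)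

lemma tensor_vacuum_diff: "tensor (e_word []) (a - b) = tensor (e_word []) a - tensor (e_word []) b"
  by (intro ell2_eqI) (simp add: coord_vacuum minus_ell2.rep_eq)

section \<open>The functional model of a contractive multi-analytic operator\<close>

locale contractive_multi_analytic =
  fixes M :: "('j, 'd::chilbert_space) fock \<Rightarrow> ('j, 'l::chilbert_space) fock"
  assumes multi_analytic: "multi_analytic M" and onorm_le: "onorm M \<le> 1"
begin

lemma M_clinear: "bounded_clinear M"
  using multi_analytic by (simp add: multi_analytic_def)

lemma M_creation: "M (creation j x) = creation j (M x)"
  using multi_analytic by (simp add: multi_analytic_def)

lemma norm_M_le: "norm (M x) \<le> norm x"
  using onorm[OF bounded_clinearD(1)[OF M_clinear], of x] onorm_le mult_right_mono[OF onorm_le norm_ge_zero[of x]]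
  by linarith

abbreviation M_adj where "M_adj \<equiv> adjoint_on UNIV M"

lemmas cinner_M = cinner_adjoint[OF M_clinear]
lemmas M_adj_clinear = bounded_clinear_adjoint[OF M_clinear norm_M_le]

section \<open>The defect operator\<close>

text \<open>The composition of \<open>M_adj\<close> with \<open>M\<close> is a symmetric
  contraction, so \<open>exists_positive_sqrt\<close> supplies the root that \<open>sqrt_op\<close>
  selects.\<close>

lemma positive_defect: "positive_op (defect M)"
  and defect_defect: "defect M (defect M x) = x - M_adj (M x)"
proof -
  have "\<exists>S. positive_op S \<and> S \<circ> S = (\<lambda>\<xi>. \<xi> - M_adj (M \<xi>))"
  proof (rule exists_positive_sqrt)
    show "bounded_clinear (\<lambda>x. M_adj (M x))"
      using M_clinear M_adj_clinear bounded_linear_compose[of M_adj M]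
      by (auto simp: bounded_clinear_def)
    show "norm (M_adj (M x)) \<le> norm x" for x
      using norm_adjoint_le[OF M_clinear norm_M_le] norm_M_le order_trans by blast
    show "cinner (M_adj (M x)) y = cinner x (M_adj (M y))" for x y
      by (simp add: cinner_adjoint'[OF M_clinear, symmetric] cinner_M[symmetric])
  qed
  from someI_ex[OF this]
  have "positive_op (defect M)" "defect M \<circ> defect M = (\<lambda>\<xi>. \<xi> - M_adj (M \<xi>))"
    by (simp_all add: defect_def sqrt_op_def)
  then show "positive_op (defect M)" "defect M (defect M x) = x - M_adj (M x)"
    by (auto simp: fun_eq_iff)
qed

lemma defect_clinear: "bounded_clinear (defect M)"
  using positive_defect by (simp add: positive_op_def)

text \<open>The root is symmetric and its square is known. Inner products of defect vectors are thus
  computed from \<open>M\<close> alone.\<close>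

lemma cinner_defect: "cinner (defect M x) (defect M y) = cinner x y - cinner (M x) (M y)"
  by (simp add: positive_op_symmetric[OF positive_defect] defect_defect cinner_diff_right cinner_M)

section \<open>The isometry \<open>W\<close> onto \<open>HD\<close>\<close>

definition W :: "('j, 'd) fock \<Rightarrow> ('j, 'l) fock \<times> ('j, 'd) fock" where
  "W x = (M x, defect M x)"

text \<open>The Hilbert space adjoint of \<open>W\<close>, written out using that
  \<open>defect M\<close> is symmetric.\<close>

definition W_adj :: "('j, 'l) fock \<times> ('j, 'd) fock \<Rightarrow> ('j, 'd) fock" where
  "W_adj h = M_adj (fst h) + defect M (snd h)"

lemma cinner_W_left: "cinner (W x) h = cinner x (W_adj h)"
  by (simp add: cinner_prod_def W_def W_adj_def cinner_M positive_op_symmetric[OF positive_defect] cinner_add_right)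

lemma W_adj_W: "W_adj (W x) = x"
  by (simp add: W_def W_adj_def defect_defect)

lemma cinner_W_W: "cinner (W x) (W y) = cinner x y"
  by (simp add: cinner_W_left W_adj_W)

lemma W_eq_0_iff: "W x = 0 \<longleftrightarrow> x = 0"
  by (metis W_adj_W cinner_W_W cinner_eq_zero_iff)

lemma W_clinear: "bounded_clinear W"
  using M_clinear defect_clinear
  by (auto simp: bounded_clinear_def W_def[abs_def] scaleC_prod_def intro!: bounded_linear_Pair)

lemma W_adj_clinear: "bounded_clinear W_adj"
  unfolding bounded_clinear_def
proof
  show "bounded_linear W_adj"
    unfolding W_adj_def[abs_def]
    by (intro bounded_linear_add bounded_linear_compose[OF bounded_clinearD(1)[OF M_adj_clinear]]
        bounded_linear_compose[OF bounded_clinearD(1)[OF defect_clinear]] bounded_linear_fst bounded_linear_snd)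
  show "\<forall>c x. W_adj (c *\<^sub>C x) = c *\<^sub>C W_adj x"
    by (simp add: W_adj_def scaleC_prod_def scaleC_add_right
        bounded_clinearD[OF M_adj_clinear] bounded_clinearD[OF defect_clinear])
qed

lemma model_HD_eq: "model_HD M = range W"
  by (simp add: model_HD_def W_def[abs_def])

text \<open>Since \<open>W_adj\<close> is a left inverse of \<open>W\<close>, the range of
  \<open>W\<close> is the fixed set of a continuous idempotent; this makes \<open>HD\<close>
  closed.\<close>

lemma model_HD_iff: "h \<in> model_HD M \<longleftrightarrow> W (W_adj h) = h"
  unfolding model_HD_eq by (metis W_adj_W rangeE rangeI)

lemma closed_csubspace_HD: "closed_csubspace (model_HD M)"
proof -
  have eq: "model_HD M = {h. W (W_adj h) = h}"
    by (auto simp: model_HD_iff)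
  have "continuous_on UNIV (\<lambda>h. W (W_adj h))"
    by (rule linear_continuous_on[OF bounded_linear_compose[OF bounded_clinearD(1)[OF W_clinear]
            bounded_clinearD(1)[OF W_adj_clinear]]])
  then show ?thesis
    unfolding closed_csubspace_def complex_vector.subspace_def eq
    by (auto intro!: closed_Collect_eq simp: bounded_clinearD[OF W_clinear] bounded_clinearD[OF W_adj_clinear])
qed

lemma orth_proj_HD: "orth_proj (model_HD M) h = W (W_adj h)"
  unfolding orth_proj_def model_HD_eq
proof (rule the_equality)
  show "W (W_adj h) \<in> range W \<and> (\<forall>z\<in>range W. cinner (h - W (W_adj h)) z = 0)"
    by (auto simp: cinner_eq_zero_sym[of "h - _"] cinner_W_left W_adj_W bounded_clinearD[OF W_adj_clinear] cinner_zero_right)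
  fix y assume y: "y \<in> range W \<and> (\<forall>z\<in>range W. cinner (h - y) z = 0)"
  then obtain x where x: "y = W x" by blast
  have "cinner z x = cinner z (W_adj h)" for z
    using y cinner_eq_zero_sym[of "h - y" "W z"]
    by (simp add: x cinner_diff_right cinner_W_left W_adj_W)
  then show "y = W (W_adj h)"
    using cinner_ext x by metis
qed

section \<open>The model space and the operators \<open>V_j\<close>\<close>

lemma model_space_eq: "model_space M = closure (UNIV \<times> range (defect M))"
  by (simp add: model_space_def closure_Times)

lemma closed_csubspace_model_space: "closed_csubspace (model_space M)"
proof -
  have "complex_vector.subspace (UNIV \<times> range (defect M) :: (('j, 'l) fock \<times> ('j, 'd) fock) set)"
  proof (rule complex_vector.subspaceI)
    show "0 \<in> UNIV \<times> range (defect M)"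
      using bounded_clinearD(5)[OF defect_clinear] by (auto simp: zero_prod_def intro: rev_image_eqI)
    show "x + y \<in> UNIV \<times> range (defect M)"
      if "x \<in> UNIV \<times> range (defect M)" "y \<in> UNIV \<times> range (defect M)" for x y :: "('j, 'l) fock \<times> ('j, 'd) fock"
      using that by (auto simp: bounded_clinearD(2)[OF defect_clinear, symmetric])
    show "c *\<^sub>C x \<in> UNIV \<times> range (defect M)"
      if "x \<in> UNIV \<times> range (defect M)" for c and x :: "('j, 'l) fock \<times> ('j, 'd) fock"
      using that by (auto simp: scaleC_prod_def bounded_clinearD(4)[OF defect_clinear, symmetric])
  qed
  then have "model_space M = closed_span (UNIV \<times> range (defect M))"
    by (simp only: model_space_eq closed_span_def complex_vector.span_eq_iff[THEN iffD2])
  then show ?thesis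
    by (simp add: closed_csubspace_closed_span)
qed

text \<open>Density transfers identities from the points where \<open>model_V\<close> is given
  explicitly to all of the model space.\<close>

lemma model_space_agree:
  fixes F G :: "('j, 'l) fock \<times> ('j, 'd) fock \<Rightarrow> complex"
  assumes "continuous_on (model_space M) F" "continuous_on (model_space M) G"
    and "\<And>\<eta> \<xi>. F (\<eta>, defect M \<xi>) = G (\<eta>, defect M \<xi>)" and "h \<in> model_space M"
  shows "F h = G h"
  using continuous_constant_on_closure[of "UNIV \<times> range (defect M)" "\<lambda>h. F h - G h" 0 h] assms
  by (auto simp: model_space_eq intro!: continuous_on_diff)

lemma defect_creation_cinner: 
  "cinner (defect M (creation i x)) (defect M (creation j y)) = (if i = j then cinner (defect M x) (defect M y) else 0)"
  by (simp add: cinner_defect M_creation cinner_creation_creation)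

text \<open>On the range of the defect operator, passing from \<open>defect M x\<close> to
  \<open>defect M (creation j x)\<close> is isometric, so it extends continuously to the
  closure.\<close>

lemma exists_model_V: "\<exists>V. continuous_on (model_space M) V \<and>
     (\<forall>\<eta> \<xi>. V (\<eta>, defect M \<xi>) = (creation j \<eta>, defect M (creation j \<xi>)))"
proof -
  have iso: "dist (defect M (creation j x)) (defect M (creation j y)) = dist (defect M x) (defect M y)" for x y
  proof -
    have "norm (defect M (creation j (x - y))) = norm (defect M (x - y))"
      by (rule norm_eq_if_cinner_eq) (simp add: defect_creation_cinner)
    then show ?thesis
      by (simp add: dist_norm bounded_clinearD[OF defect_clinear] linear_simps[OF bounded_linear_creation])
  qed
  \<comment> \<open>The preimage chosen by \<open>inv\<close> is immaterial: by \<open>iso\<close>,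
    preimages of the same point give images at distance 0.\<close>
  define f where "f k = defect M (creation j (inv (defect M) k))" for k
  have f: "f (defect M x) = defect M (creation j x)" for x
    using iso[of "inv (defect M) (defect M x)" x] by (simp add: f_def f_inv_into_f)
  have "uniformly_continuous_on (range (defect M)) f"
    unfolding uniformly_continuous_on_def by (auto simp: f iso)
  then obtain g where g: "uniformly_continuous_on (closure (range (defect M))) g"
    "\<And>x. x \<in> range (defect M) \<Longrightarrow> f x = g x"
    using uniformly_continuous_on_extension_on_closure[of "range (defect M)" f] by metis
  define V where "V h = (creation j (fst h), g (snd h))" for h :: "('j, 'l) fock \<times> ('j, 'd) fock"
  have "continuous_on (model_space M) (\<lambda>h. g (snd h))"
    by (rule continuous_on_compose2[OF uniformly_continuous_imp_continuous[OF g(1)] continuous_on_snd])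
       (auto simp: model_space_def)
  moreover have "continuous_on (model_space M) (\<lambda>h. creation j (fst h))"
    by (intro bounded_linear.continuous_on[OF bounded_linear_creation] continuous_intros)
  ultimately have "continuous_on (model_space M) V"
    unfolding V_def by (intro continuous_on_Pair)
  moreover have "V (\<eta>, defect M \<xi>) = (creation j \<eta>, defect M (creation j \<xi>))" for \<eta> \<xi>
    by (simp add: V_def g(2)[symmetric] f)
  ultimately show ?thesis by blast
qed

lemma continuous_model_V: "continuous_on (model_space M) (model_V M j)"
  and model_V_apply: "model_V M j (\<eta>, defect M \<xi>) = (creation j \<eta>, defect M (creation j \<xi>))"
  using someI_ex[OF exists_model_V[of j]] by (auto simp: model_V_def)

lemma model_V_W: "model_V M j (W x) = W (creation j x)"
  by (simp add: W_def model_V_apply M_creation)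

lemma model_V_in_model_space: 
  assumes "h \<in> model_space M" shows "model_V M j h \<in> model_space M"
proof -
  have "model_V M j ` closure (UNIV \<times> range (defect M)) \<subseteq> closure (UNIV \<times> range (defect M))"
    using continuous_model_V[of j, unfolded model_space_eq]
    by (rule image_closure_subset) (auto simp: model_V_apply intro!: subsetD[OF closure_subset])
  then show ?thesis
    using assms by (auto simp: model_space_eq)
qed

lemma continuous_cinner_model_V: "continuous_on (model_space M) (\<lambda>h. cinner (model_V M j h) y)"
  by (intro continuous_on_cinner continuous_model_V continuous_intros)

text \<open>\<open>W (creation j x)\<close> equals \<open>V_j (W x)\<close>, and the
  \<open>V_j\<close> are isometries with orthogonal ranges. In particular \<open>V_i\<close> sends
  \<open>HA\<close> into the complement of every \<open>V_j HD\<close>.\<close>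

lemma cinner_model_V_W_creation:
  assumes "h \<in> model_space M"
  shows "cinner (model_V M i h) (W (creation j x)) = (if i = j then cinner h (W x) else 0)"
proof (rule model_space_agree[OF _ _ _ assms])
  show "continuous_on (model_space M) (\<lambda>h. if i = j then cinner h (W x) else 0)"
    by (cases "i = j") (auto intro!: continuous_on_cinner continuous_intros)
  show "cinner (model_V M i (\<eta>, defect M \<xi>)) (W (creation j x))
      = (if i = j then cinner (\<eta>, defect M \<xi>) (W x) else 0)" for \<eta> \<xi>
    by (simp add: model_V_apply W_def cinner_prod_def M_creation cinner_creation_creation defect_creation_cinner)
qed (rule continuous_cinner_model_V)

text \<open>By \<open>cinner_defect\<close> the second component gives two terms; the one pairing
  \<open>creation j \<xi>\<close> with the vacuum vector \<open>v\<close> vanishes, the other yields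
  \<open>M \<xi>\<close>.\<close>

lemma cinner_model_V_W_vacuum:
  assumes v: "v \<in> vacuum_space"
  shows "cinner (model_V M j (\<eta>, defect M \<xi>)) (W v) = cinner (\<eta> - M \<xi>) (annihilation j (M v))"
  using v by (simp add: model_V_apply W_def cinner_prod_def cinner_defect M_creation cinner_creation
      vacuum_space_iff cinner_zero_right cinner_diff_left)

section \<open>The kernel of the row adjoint\<close>

text \<open>Through \<open>W\<close> the restriction of \<open>V_j\<close> to \<open>HD\<close>
  becomes \<open>creation j\<close>, hence its adjoint becomes \<open>annihilation j\<close>, and
  the common kernel of these is the vacuum space.\<close>

lemma ker_VD_adj_eq: "ker_VD_adj M = W ` vacuum_space"
proof -
  have adj: "adjoint_on (model_HD M) (model_V M j) (W x) = W (annihilation j x)" for j x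
    unfolding adjoint_on_def model_HD_eq
  proof (rule the_equality)
    show "W (annihilation j x) \<in> range W \<and>
      (\<forall>y\<in>range W. cinner (model_V M j y) (W x) = cinner y (W (annihilation j x)))"
      by (simp add: model_V_W cinner_W_W cinner_creation)
    fix z assume z: "z \<in> range W \<and> (\<forall>y\<in>range W. cinner (model_V M j y) (W x) = cinner y z)"
    then obtain u where "z = W u" by blast
    with z show "z = W (annihilation j x)"
      by (simp add: model_V_W cinner_W_W cinner_creation) (metis cinner_ext)
  qed
  show ?thesis
    unfolding ker_VD_adj_def using adj
    by (auto simp: model_HD_eq W_eq_0_iff vacuum_space_iff simp del: split_paired_All)
qed

text \<open>The kernel of an adjoint is the complement of the range; in this form closedness is
  immediate.\<close>

lemma ker_VD_adj_eq_orth_diff: "ker_VD_adj M = model_HD M \<ominus> (\<Union>j. range (\<lambda>x. W (creation j x)))"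
proof -
  have "x \<in> vacuum_space \<longleftrightarrow> (\<forall>j y. cinner (W x) (W (creation j y)) = 0)" for x
  proof -
    have "annihilation j x = 0 \<longleftrightarrow> (\<forall>y. cinner (W x) (W (creation j y)) = 0)" for j
      unfolding cinner_W_W cinner_eq_zero_sym[of x] cinner_creation
      by (metis cinner_eq_zero_iff cinner_zero_right)
    then show ?thesis
      by (simp add: vacuum_space_iff)
  qed
  then show ?thesis
    by (auto simp: ker_VD_adj_eq model_HD_eq orth_diff_def)
qed

lemma closed_csubspace_ker: "closed_csubspace (ker_VD_adj M)"
  unfolding ker_VD_adj_eq_orth_diff by (intro closed_csubspace_orth_diff closed_csubspace_HD)

section \<open>\<open>LA\<close> and \<open>LE\<close> as closed subspaces of the kernel\<close>

lemma diff_proj_in_HA: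
  assumes "h \<in> model_space M"
  shows "h - W (W_adj h) \<in> model_HA M"
proof -
  have "W x \<in> model_space M" for x
    using closure_subset[of "range (defect M)"] by (auto simp: W_def model_space_def)
  then have "h - W (W_adj h) \<in> model_space M"
    using assms closed_csubspace_model_space unfolding closed_csubspace_def
    by (auto intro: complex_vector.subspace_diff)
  moreover have "cinner (h - W (W_adj h)) (W x) = 0" for x
    unfolding cinner_eq_zero_sym[of _ "W x"]
    by (simp add: cinner_W_left W_adj_W bounded_clinearD[OF W_adj_clinear] cinner_zero_right)
  ultimately show ?thesis
    by (auto simp: model_HA_def orth_diff_def model_HD_eq)
qed

lemma HA_orth_W: "h \<in> model_HA M \<Longrightarrow> cinner h (W x) = 0"
  by (simp add: model_HA_def orth_diff_def model_HD_eq)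

lemma HA_subset_model_space: "h \<in> model_HA M \<Longrightarrow> h \<in> model_space M"
  by (simp add: model_HA_def orth_diff_def)

text \<open>The component of \<open>x\<close> in \<open>HA\<close> is orthogonal both to
  \<open>x\<close> and to the \<open>HD\<close> component, hence to itself, so \<open>x\<close> lies
  in \<open>HD\<close>. All generators of the span are orthogonal to \<open>V_j HD\<close>, hence so
  is \<open>x\<close>.\<close>

lemma LA_subset_ker: "model_LA M \<subseteq> ker_VD_adj M"
proof
  fix x assume "x \<in> model_LA M"
  then have x: "x \<in> closed_span (model_HA M \<union> (\<Union>j. model_V M j ` model_HA M))"
    and x_orth: "\<And>h. h \<in> model_HA M \<Longrightarrow> cinner x h = 0"
    by (auto simp: model_LA_def orth_diff_def)
  have "closed_span (model_HA M \<union> (\<Union>j. model_V M j ` model_HA M)) \<subseteq> model_space M"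
    by (rule closed_span_minimal) (auto simp: HA_subset_model_space model_V_in_model_space closed_csubspace_model_space)
  with x have HA: "x - W (W_adj x) \<in> model_HA M"
    by (intro diff_proj_in_HA) auto
  then have "cinner (x - W (W_adj x)) (x - W (W_adj x)) = 0"
    using x_orth[OF HA] HA_orth_W[OF HA, of "W_adj x"]
      cinner_eq_zero_sym[of "W (W_adj x)" "x - W (W_adj x)"]
    by (simp add: cinner_diff_left[of x])
  then have HD: "x \<in> model_HD M"
    by (simp add: model_HD_iff cinner_eq_zero_iff)
  have "cinner x (W (creation j y)) = 0" for j y
    using x by (rule orth_closed_span[rotated])
      (auto simp: HA_orth_W cinner_model_V_W_creation HA_subset_model_space)
  with HD show "x \<in> ker_VD_adj M"
    by (auto simp: ker_VD_adj_eq_orth_diff orth_diff_def)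
qed

text \<open>The projection is \<open>W (M_adj \<eta>)\<close>. As \<open>M\<close> commutes with
  creations, \<open>M_adj\<close> commutes with annihilations and so preserves vacuum
  vectors.\<close>

lemma proj_vacuum_in_ker:
  assumes "\<eta> \<in> vacuum_space"
  shows "orth_proj (model_HD M) (\<eta>, 0) \<in> ker_VD_adj M"
proof -
  have "annihilation j (M_adj \<eta>) = 0" for j
    by (rule cinner_ext)
       (use assms in \<open>simp add: cinner_creation[symmetric] cinner_M[symmetric] M_creation
          cinner_zero_right; simp add: cinner_creation vacuum_space_iff cinner_zero_right\<close>)
  then show ?thesis
    by (auto simp: orth_proj_HD ker_VD_adj_eq W_adj_def bounded_clinearD[OF defect_clinear] vacuum_space_iff)
qed

lemma LA_subset_LE: "model_LA M \<subseteq> model_LE M"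
  unfolding model_LE_def by (rule order_trans[OF _ closed_span_superset]) simp

lemma LE_subset_ker: "model_LE M \<subseteq> ker_VD_adj M"
  unfolding model_LE_def
  using LA_subset_ker proj_vacuum_in_ker by (intro closed_span_minimal closed_csubspace_ker) auto

lemma closed_csubspace_LA: "closed_csubspace (model_LA M)"
  unfolding model_LA_def by (intro closed_csubspace_orth_diff closed_csubspace_closed_span)

lemma closed_csubspace_LE: "closed_csubspace (model_LE M)"
  unfolding model_LE_def by (rule closed_csubspace_closed_span)

section \<open>Orthogonality to \<open>LA\<close> and to \<open>LE\<close>\<close>

text \<open>The projection of \<open>V_j h\<close> onto \<open>HD\<close> differs from
  \<open>V_j h\<close> by a vector of \<open>HA\<close>. It therefore lies in \<open>LA\<close> and
  has the same inner product with \<open>W x\<close>.\<close>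

lemma orth_LA_iff_orth_model_V:
  "(\<forall>z\<in>model_LA M. cinner z (W x) = 0) \<longleftrightarrow> (\<forall>j. \<forall>h\<in>model_HA M. cinner (model_V M j h) (W x) = 0)"
proof
  let ?N = "closed_span (model_HA M \<union> (\<Union>j. model_V M j ` model_HA M))"
  assume orth: "\<forall>z\<in>model_LA M. cinner z (W x) = 0"
  show "\<forall>j. \<forall>h\<in>model_HA M. cinner (model_V M j h) (W x) = 0"
  proof (intro allI ballI)
    fix j h assume h: "h \<in> model_HA M"
    define v where "v = model_V M j h"
    have v: "v \<in> model_space M"
      using h unfolding v_def by (intro model_V_in_model_space HA_subset_model_space)
    have vN: "v \<in> ?N"
      using h unfolding v_def by (intro subsetD[OF closed_span_superset]) blast
    have a: "v - W (W_adj v) \<in> model_HA M"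
      by (rule diff_proj_in_HA[OF v])
    then have aN: "v - W (W_adj v) \<in> ?N"
      by (intro subsetD[OF closed_span_superset]) simp
    have "complex_vector.subspace ?N"
      by (rule closed_csubspace_closed_span[unfolded closed_csubspace_def, THEN conjunct1])
    from complex_vector.subspace_diff[OF this vN aN] have "W (W_adj v) \<in> ?N"
      by simp
    moreover have "cinner (W (W_adj v)) y = 0" if "y \<in> model_HA M" for y
      using HA_orth_W[OF that] by (simp add: cinner_eq_zero_sym[of _ y])
    ultimately have "W (W_adj v) \<in> model_LA M"
      by (simp add: model_LA_def orth_diff_def)
    with orth have "cinner (W (W_adj v)) (W x) = 0"
      by (rule bspec)
    then show "cinner (model_V M j h) (W x) = 0"
      using HA_orth_W[OF a, of x] by (simp add: cinner_diff_left v_def)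
  qed
next
  assume V: "\<forall>j. \<forall>h\<in>model_HA M. cinner (model_V M j h) (W x) = 0"
  have "cinner z (W x) = 0" if "z \<in> model_HA M \<union> (\<Union>j. model_V M j ` model_HA M)" for z
    using that V HA_orth_W by blast
  then show "\<forall>z\<in>model_LA M. cinner z (W x) = 0"
    unfolding model_LA_def orth_diff_def using orth_closed_span by blast
qed

text \<open>By \<open>cinner_model_V_W_creation\<close>, the vector \<open>W v\<close> is orthogonal to \<open>V\<^sub>j HD\<close>. If it is also
  orthogonal to \<open>V\<^sub>j HA\<close>, then it is orthogonal to \<open>V\<^sub>j (\<eta>, 0)\<close> for all \<open>\<eta>\<close>, that is,
  \<open>\<eta>\<close> is orthogonal to the image of \<open>M v\<close> under the adjoint of \<open>L\<^sub>j \<otimes> I\<close>.\<close>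

lemma orth_LA_iff:
  assumes v: "v \<in> vacuum_space"
  shows "(\<forall>z\<in>model_LA M. cinner z (W v) = 0) \<longleftrightarrow> M v \<in> vacuum_space"
  unfolding orth_LA_iff_orth_model_V
proof
  assume orth: "\<forall>j. \<forall>h\<in>model_HA M. cinner (model_V M j h) (W v) = 0"
  show "M v \<in> vacuum_space"
    unfolding vacuum_space_iff
  proof
    fix j
    let ?g = "annihilation j (M v)" and ?\<xi> = "M_adj (annihilation j (M v))"
    \<comment> \<open>The second component of this residual is an explicit defect vector, so
      \<open>cinner_model_V_W_vacuum\<close> applies; the two \<open>M\<close> terms there cancel
      and leave the squared norm of \<open>?g\<close>.\<close>
    have "(?g, 0) - W (W_adj (?g, 0)) = (?g - M ?\<xi>, defect M (- ?\<xi>))"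
      using bounded_clinearD(3)[OF defect_clinear, of 0 ?\<xi>]
      by (simp add: W_def W_adj_def bounded_clinearD(5)[OF defect_clinear])
    moreover have "(?g, 0) \<in> model_space M"
      using closed_csubspace_model_space bounded_clinearD(5)[OF defect_clinear] closure_subset[of "range (defect M)"]
      by (auto simp: model_space_def intro: range_eqI[of _ _ 0])
    ultimately have "(?g - M ?\<xi>, defect M (- ?\<xi>)) \<in> model_HA M"
      using diff_proj_in_HA by metis
    then have "cinner (?g - M ?\<xi> - M (- ?\<xi>)) ?g = 0"
      using orth cinner_model_V_W_vacuum[OF v] by metis
    then show "annihilation j (M v) = 0"
      using bounded_clinearD(3)[OF M_clinear, of 0 ?\<xi>]
      by (simp add: bounded_clinearD(5)[OF M_clinear] cinner_eq_zero_iff)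
  qed
next
  assume "M v \<in> vacuum_space"
  \<comment> \<open>The formula of \<open>cinner_model_V_W_vacuum\<close> vanishes at the dense
    points, hence on the whole model space.\<close>
  then have "cinner (model_V M j h) (W v) = 0" if "h \<in> model_space M" for h j
    by (intro model_space_agree[OF continuous_cinner_model_V _ _ that, where G = "\<lambda>_. 0"])
       (simp_all add: cinner_model_V_W_vacuum[OF v] vacuum_space_iff cinner_zero_right)
  then show "\<forall>j. \<forall>h\<in>model_HA M. cinner (model_V M j h) (W v) = 0"
    using HA_subset_model_space by blast
qed

text \<open>The projection of \<open>(\<eta>, 0)\<close> pairs with \<open>W v\<close> as
  \<open>\<eta>\<close> pairs with \<open>M v\<close>. Orthogonality to \<open>LA\<close> makes
  \<open>M v\<close> a vacuum vector, so \<open>M v\<close> itself is an admissible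
  \<open>\<eta>\<close>.\<close>

lemma orth_LE_iff:
  assumes v: "v \<in> vacuum_space"
  shows "(\<forall>z\<in>model_LE M. cinner z (W v) = 0) \<longleftrightarrow> M v = 0"
proof
  assume orth: "\<forall>z\<in>model_LE M. cinner z (W v) = 0"
  with LA_subset_LE have "M v \<in> vacuum_space"
    unfolding orth_LA_iff[OF v, symmetric] by auto
  then have "orth_proj (model_HD M) (M v, 0) \<in> model_LE M"
    unfolding model_LE_def by (intro subsetD[OF closed_span_superset]) simp
  with orth have "cinner (W (W_adj (M v, 0))) (W v) = 0"
    by (simp add: orth_proj_HD)
  then have "cinner (M_adj (M v)) v = 0"
    by (simp add: cinner_W_W W_adj_def bounded_clinearD[OF defect_clinear])
  then show "M v = 0"
    by (simp add: cinner_adjoint'[OF M_clinear, symmetric] cinner_eq_zero_iff)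
next
  assume Mv: "M v = 0"
  then have "\<forall>z\<in>model_LA M. cinner z (W v) = 0"
    using orth_LA_iff[OF v] by (simp add: zero_in_vacuum_space)
  moreover have "cinner (orth_proj (model_HD M) (\<eta>, 0)) (W v) = 0" for \<eta>
    by (simp add: orth_proj_HD cinner_W_W W_adj_def bounded_clinearD[OF defect_clinear]
        cinner_adjoint'[OF M_clinear, symmetric] Mv cinner_zero_right)
  ultimately have "cinner z (W v) = 0"
    if "z \<in> model_LA M \<union> orth_proj (model_HD M) ` (vacuum_space \<times> {0})" for z
    using that by auto
  then show "\<forall>z\<in>model_LE M. cinner z (W v) = 0"
    unfolding model_LE_def using orth_closed_span by blast
qed

text \<open>Inside the kernel every vector is \<open>W v\<close> with \<open>v\<close> vacuum, so
  \<open>closed_csubspace_eqI\<close> has to be checked only on such vectors.\<close>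

lemma eq_if_no_orth:
  assumes A: "closed_csubspace A" "A \<subseteq> B" and B: "closed_csubspace B" "B \<subseteq> ker_VD_adj M"
    and orth: "\<And>v. v \<in> vacuum_space \<Longrightarrow> W v \<in> B \<Longrightarrow> \<forall>z\<in>A. cinner z (W v) = 0 \<Longrightarrow> W v = 0"
  shows "A = B"
proof (rule closed_csubspace_eqI[OF A(1) _ A(2)])
  show "complex_vector.subspace B"
    using B(1) by (simp add: closed_csubspace_def)
  fix y assume y: "y \<in> B" "\<And>z. z \<in> A \<Longrightarrow> cinner y z = 0"
  then obtain v where "v \<in> vacuum_space" "y = W v"
    using B(2) by (auto simp: ker_VD_adj_eq)
  moreover have "\<forall>z\<in>A. cinner z y = 0"
    using y(2) by (simp add: cinner_eq_zero_sym[of _ y])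
  ultimately show "y = 0"
    using y(1) orth by simp
qed

end

theorem theorem2p4:
  fixes M :: "('j::finite, 'd::chilbert_space) fock \<Rightarrow> ('j, 'l::chilbert_space) fock"
  assumes "multi_analytic M" and "onorm M \<le> 1"
  shows "(model_LA M = model_LE M \<longleftrightarrow>
           (\<forall>\<delta>. symbol M \<delta> \<in> vacuum_space \<longrightarrow> symbol M \<delta> = 0))
       \<and> (model_LE M = ker_VD_adj M \<longleftrightarrow> inj (symbol M))
       \<and> (model_LA M = ker_VD_adj M \<longleftrightarrow> no_constant_directions (symbol M))"
proof -
  interpret contractive_multi_analytic M
    using assms by unfold_locales
  let ?e = "tensor (e_word []) :: 'd \<Rightarrow> ('j, 'd) fock"
  have e: "?e \<delta> \<in> vacuum_space" for \<delta>
    by (simp add: vacuum_space_def)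
  have W_ker: "W (?e \<delta>) \<in> ker_VD_adj M" for \<delta>
    using e by (simp add: ker_VD_adj_eq)
  have orth_ker: "(\<forall>z\<in>ker_VD_adj M. cinner z (W (?e \<delta>)) = 0) \<longleftrightarrow> \<delta> = 0" for \<delta>
  proof
    assume "\<forall>z\<in>ker_VD_adj M. cinner z (W (?e \<delta>)) = 0"
    then have "cinner (W (?e \<delta>)) (W (?e \<delta>)) = 0"
      using W_ker by (rule bspec)
    then show "\<delta> = 0"
      by (simp only: cinner_eq_zero_iff W_eq_0_iff tensor_vacuum_0_iff)
  next
    assume "\<delta> = 0"
    then have "W (?e \<delta>) = 0"
      by (simp only: W_eq_0_iff tensor_vacuum_0_iff)
    then show "\<forall>z\<in>ker_VD_adj M. cinner z (W (?e \<delta>)) = 0"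
      by (simp add: cinner_zero_right)
  qed
  have orth_LA: "(\<forall>z\<in>model_LA M. cinner z (W (?e \<delta>)) = 0) \<longleftrightarrow> symbol M \<delta> \<in> vacuum_space"
    and orth_LE: "(\<forall>z\<in>model_LE M. cinner z (W (?e \<delta>)) = 0) \<longleftrightarrow> symbol M \<delta> = 0" for \<delta>
    using orth_LA_iff[OF e] orth_LE_iff[OF e] by (simp_all add: symbol_def)
  \<comment> \<open>If \<open>W v\<close> lies in \<open>B\<close> and is orthogonal to
    \<open>A\<close>, the condition makes it orthogonal to \<open>B\<close>, hence to itself. Each
    claim then compares two of the criteria \<open>orth_LA\<close>, \<open>orth_LE\<close> and
    \<open>orth_ker\<close>.\<close>
  have eq_iff: "A = B \<longleftrightarrow> (\<forall>\<delta>. (\<forall>z\<in>A. cinner z (W (?e \<delta>)) = 0) \<longrightarrow> (\<forall>z\<in>B. cinner z (W (?e \<delta>)) = 0))"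
    if "closed_csubspace A" "A \<subseteq> B" "closed_csubspace B" "B \<subseteq> ker_VD_adj M" for A B
  proof
    assume *: "\<forall>\<delta>. (\<forall>z\<in>A. cinner z (W (?e \<delta>)) = 0) \<longrightarrow> (\<forall>z\<in>B. cinner z (W (?e \<delta>)) = 0)"
    show "A = B"
      using that
    proof (rule eq_if_no_orth)
      fix v assume "v \<in> vacuum_space" "W v \<in> B" "\<forall>z\<in>A. cinner z (W v) = 0"
      with * have "cinner (W v) (W v) = 0"
        by (auto simp: vacuum_space_def)
      then show "W v = 0"
        by (simp add: cinner_eq_zero_iff)
    qed
  qed simp
  \<comment> \<open>The symbol is additive, so injectivity takes the kernel form that the comparison
    of \<open>orth_LE\<close> with \<open>orth_ker\<close> produces.\<close>
  have inj_iff: "inj (symbol M) \<longleftrightarrow> (\<forall>\<delta>. symbol M \<delta> = 0 \<longrightarrow> \<delta> = 0)"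
  proof -
    have diff: "symbol M (a - b) = symbol M a - symbol M b" for a b
      by (simp add: symbol_def tensor_vacuum_diff bounded_clinearD[OF M_clinear])
    then have "symbol M 0 = 0"
      using diff[of 0 0] by simp
    with diff show ?thesis
      unfolding inj_def by (metis eq_iff_diff_eq_0)
  qed
  show ?thesis
    unfolding no_constant_directions_def inj_iff
      eq_iff[OF closed_csubspace_LA LA_subset_LE closed_csubspace_LE LE_subset_ker]
      eq_iff[OF closed_csubspace_LE LE_subset_ker closed_csubspace_ker order_refl]
      eq_iff[OF closed_csubspace_LA LA_subset_ker closed_csubspace_ker order_refl]
      orth_LA orth_LE orth_ker
    by (intro conjI refl)
qed

end
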